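(* There is an $8$-approximation algorithm for the na-ROF evaluation problem whose running time is polynomial in $n$ and $\sum_{i=1}^n c_i$ (pseudo-polynomial); in the unit cost case ($c_i=1$ for all $i$) it runs in polynomial time.
   Context: na-ROF evaluation problem: the input is a read-once formula $\phi(x_1,\dots,x_n)$ (a rooted tree whose internal nodes are labeled AND or OR and whose $n$ leaves are labeled by distinct Boolean variables $x_1,\dots,x_n$), probabilities $p_i\in(0,1)$ and positive integer costs $c_i$. The input is a random assignment drawn from the product distribution with $P[x_i=1]=p_i$, the $x_i$ independent. Test $i$ reveals $x_i$ at cost $c_i$. A solution is a permutation of the tests $\{1,\dots,n\}$; tests are performed in that order until the outcomes performed so far determine the value of $\phi$ (i.e., $\phi$ takes the same value on all assignments consistent with the observed outcomes). The objective is to minimize the expected total cost of tests performed. Equivalently, with $S_j$ the set of the first $j$ tests, $f(S)=\sum_{i\in S}c_i$ and $g(S)$ the probability that the outcomes of the tests in $S$ determine the value of $\phi$, the expected cost is $\sum_{j=1}^n f(S_j)(g(S_j)-g(S_{j-1}))$. An $8$-approximation returns a permutation with expected cost at most $8$ times the optimum. *)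

theory Defs
  imports
    "HOL-Probability.Product_PMF"
    "HOL-Combinatorics.Multiset_Permutations"
    "HOL-Computational_Algebra.Polynomial"
begin

section \<open>Read-once formulas\<close>

datatype formula = Leaf nat | And "formula list" | Or "formula list"

fun holds :: "formula \<Rightarrow> (nat \<Rightarrow> bool) \<Rightarrow> bool" where
  "holds (Leaf i) x = x i"
| "holds (And fs) x = (\<forall>f\<in>set fs. holds f x)"
| "holds (Or fs) x = (\<exists>f\<in>set fs. holds f x)"

fun leaves :: "formula \<Rightarrow> nat list" where
  "leaves (Leaf i) = [i]"
| "leaves (And fs) = concat (map leaves fs)"
| "leaves (Or fs) = concat (map leaves fs)"

text \<open>Every internal node has at least two children. Without this convention the size of the
  tree would not be bounded in terms of the number of leaves, and no running time could be
  bounded in terms of the number of variables.\<close>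

fun branching :: "formula \<Rightarrow> bool" where
  "branching (Leaf i) = True"
| "branching (And fs) = (length fs \<ge> 2 \<and> (\<forall>f\<in>set fs. branching f))"
| "branching (Or fs) = (length fs \<ge> 2 \<and> (\<forall>f\<in>set fs. branching f))"

text \<open>The variables (equivalently the tests) are numbered from \<open>0\<close> to \<open>n - 1\<close>.\<close>

definition read_once :: "nat \<Rightarrow> formula \<Rightarrow> bool" where
  "read_once n \<phi> \<longleftrightarrow> branching \<phi> \<and> distinct (leaves \<phi>) \<and> set (leaves \<phi>) = {..<n}"


section \<open>The evaluation problem\<close>

definition na_ROF_instance :: "nat \<Rightarrow> formula \<Rightarrow> (nat \<Rightarrow> real) \<Rightarrow> (nat \<Rightarrow> nat) \<Rightarrow> bool" where
  "na_ROF_instance n \<phi> p c \<longleftrightarrow>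
     read_once n \<phi> \<and> (\<forall>i<n. 0 < p i \<and> p i < 1) \<and> (\<forall>i<n. 0 < c i)"

text \<open>The outcomes of the tests in \<open>S\<close>, read off from the assignment \<open>x\<close>, determine the value
  of the formula.\<close>

definition determined :: "formula \<Rightarrow> nat set \<Rightarrow> (nat \<Rightarrow> bool) \<Rightarrow> bool" where
  "determined \<phi> S x \<longleftrightarrow> (\<forall>y. (\<forall>i\<in>S. y i = x i) \<longrightarrow> holds \<phi> y = holds \<phi> x)"

definition num_tests :: "formula \<Rightarrow> nat list \<Rightarrow> (nat \<Rightarrow> bool) \<Rightarrow> nat" where
  "num_tests \<phi> \<pi> x = (LEAST j. determined \<phi> (set (take j \<pi>)) x)"

definition testing_cost :: "formula \<Rightarrow> (nat \<Rightarrow> nat) \<Rightarrow> nat list \<Rightarrow> (nat \<Rightarrow> bool) \<Rightarrow> nat" where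
  "testing_cost \<phi> c \<pi> x = (\<Sum>i\<leftarrow>take (num_tests \<phi> \<pi> x) \<pi>. c i)"

definition assignment_pmf :: "nat \<Rightarrow> (nat \<Rightarrow> real) \<Rightarrow> (nat \<Rightarrow> bool) pmf" where
  "assignment_pmf n p = Pi_pmf {..<n} False (\<lambda>i. bernoulli_pmf (p i))"

definition expected_cost ::
    "nat \<Rightarrow> formula \<Rightarrow> (nat \<Rightarrow> real) \<Rightarrow> (nat \<Rightarrow> nat) \<Rightarrow> nat list \<Rightarrow> real" where
  "expected_cost n \<phi> p c \<pi> =
     measure_pmf.expectation (assignment_pmf n p) (\<lambda>x. real (testing_cost \<phi> c \<pi> x))"

definition optimal_cost :: "nat \<Rightarrow> formula \<Rightarrow> (nat \<Rightarrow> real) \<Rightarrow> (nat \<Rightarrow> nat) \<Rightarrow> real" where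
  "optimal_cost n \<phi> p c = Min (expected_cost n \<phi> p c ` permutations_of_set {..<n})"


section \<open>Algorithms and running time\<close>

text \<open>
  Algorithms are first-order recursive programs over cons cells whose atoms are natural numbers
  and exact real numbers, with unit cost for each evaluation step; this is the usual unit-cost
  (real RAM) measure, in which the probabilities are real numbers of no particular representation.

  The primitives are chosen so that unit cost is not abused. Natural numbers can only be added,
  subtracted (truncated at zero) and compared, so that their binary length grows by at most one
  per step. Real numbers can be added, subtracted, multiplied, divided and compared, but there is
  no rounding or other conversion from the reals to the natural numbers, and the only real
  constants are those obtained from natural numbers. There is no equality test on compound values.
\<close>

datatype val = NatV nat | RealV real | EmptyV | PairV val val

datatype prim =
    MkNat nat | MkEmpty | MkPair | First | Second | IsPair
  | Add | Sub | Mult | Divide | Less | ToReal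

text \<open>Truth values are represented by \<open>NatV 1\<close> and \<open>NatV 0\<close>. A primitive applied to arguments
  that are not covered by a rule has no result, and the program is then stuck.\<close>

inductive prim_sem :: "prim \<Rightarrow> val list \<Rightarrow> val \<Rightarrow> bool" where
  "prim_sem (MkNat k) [] (NatV k)"
| "prim_sem MkEmpty [] EmptyV"
| "prim_sem MkPair [a, b] (PairV a b)"
| "prim_sem First [PairV a b] a"
| "prim_sem Second [PairV a b] b"
| "prim_sem IsPair [v] (NatV (case v of PairV a b \<Rightarrow> 1 | _ \<Rightarrow> 0))"
| "prim_sem Add [NatV k, NatV l] (NatV (k + l))"
| "prim_sem Sub [NatV k, NatV l] (NatV (k - l))"
| "prim_sem Less [NatV k, NatV l] (NatV (if k < l then 1 else 0))"
| "prim_sem Add [RealV x, RealV y] (RealV (x + y))"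
| "prim_sem Sub [RealV x, RealV y] (RealV (x - y))"
| "prim_sem Mult [RealV x, RealV y] (RealV (x * y))"
| "y \<noteq> 0 \<Longrightarrow> prim_sem Divide [RealV x, RealV y] (RealV (x / y))"
| "prim_sem Less [RealV x, RealV y] (NatV (if x < y then 1 else 0))"
| "prim_sem ToReal [NatV k] (RealV (real k))"

lemma prim_sem_deterministic: "prim_sem f vs v \<Longrightarrow> prim_sem f vs v' \<Longrightarrow> v' = v"
  by (erule prim_sem.cases; erule prim_sem.cases; simp)

text \<open>\<open>Ref i\<close> is the \<open>i\<close>-th entry of the current environment, \<open>Bind\<close> pushes a value onto the
  environment, and \<open>Call g\<close> evaluates the \<open>g\<close>-th function body of the program in the environment
  consisting of the arguments. Execution starts with the body at the head of the program.\<close>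

datatype exp =
    Ref nat
  | Prim prim "exp list"
  | Cond exp exp exp
  | Bind exp exp
  | Call nat "exp list"

type_synonym program = "exp list"

text \<open>\<open>eval P env e v t\<close>: in the environment \<open>env\<close>, the evaluation of \<open>e\<close> terminates with value
  \<open>v\<close> after \<open>t\<close> steps. The program is a fixed finite object, so each step amounts to a bounded
  number of pointer manipulations and arithmetic operations.\<close>

inductive
  eval :: "program \<Rightarrow> val list \<Rightarrow> exp \<Rightarrow> val \<Rightarrow> nat \<Rightarrow> bool" and
  evals :: "program \<Rightarrow> val list \<Rightarrow> exp list \<Rightarrow> val list \<Rightarrow> nat \<Rightarrow> bool"
  for P :: program
where
  Ref: "i < length env \<Longrightarrow> eval P env (Ref i) (env ! i) 1"
| Prim: "\<lbrakk>evals P env es vs t; prim_sem f vs v\<rbrakk> \<Longrightarrow> eval P env (Prim f es) v (t + 1)"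
| Cond_true: "\<lbrakk>eval P env b (NatV k) s; k \<noteq> 0; eval P env e1 v t\<rbrakk> \<Longrightarrow>
    eval P env (Cond b e1 e2) v (s + t + 1)"
| Cond_false: "\<lbrakk>eval P env b (NatV 0) s; eval P env e2 v t\<rbrakk> \<Longrightarrow>
    eval P env (Cond b e1 e2) v (s + t + 1)"
| Bind: "\<lbrakk>eval P env e1 u s; eval P (u # env) e2 v t\<rbrakk> \<Longrightarrow>
    eval P env (Bind e1 e2) v (s + t + 1)"
| Call: "\<lbrakk>evals P env es vs s; g < length P; eval P vs (P ! g) v t\<rbrakk> \<Longrightarrow>
    eval P env (Call g es) v (s + t + 1)"
| Evals_Nil: "evals P env [] [] 0"
| Evals_Cons: "\<lbrakk>eval P env e v s; evals P env es vs t\<rbrakk> \<Longrightarrow>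
    evals P env (e # es) (v # vs) (s + t)"

lemma eval_deterministic:
  "eval P env e v t \<Longrightarrow> \<forall>v' t'. eval P env e v' t' \<longrightarrow> v' = v \<and> t' = t"
  "evals P env es vs t \<Longrightarrow> \<forall>vs' t'. evals P env es vs' t' \<longrightarrow> vs' = vs \<and> t' = t"
proof (induction rule: eval_evals.inducts)
  case (Ref i env)
  then show ?case by (auto elim: eval.cases)
next
  case (Prim env es vs t f v)
  show ?case
  proof (intro allI impI)
    fix v' t'
    assume "eval P env (Prim f es) v' t'"
    then show "v' = v \<and> t' = t + 1"
      by cases (use Prim prim_sem_deterministic in metis)
  qed
next
  case (Cond_true env b k s e1 v t e2)
  show ?case
  proof (intro allI impI)
    fix v' t'
    assume "eval P env (Cond b e1 e2) v' t'"
    then show "v' = v \<and> t' = s + t + 1"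
      by cases (use Cond_true val.inject(1) in metis)+
  qed
next
  case (Cond_false env b s e2 v t e1)
  show ?case
  proof (intro allI impI)
    fix v' t'
    assume "eval P env (Cond b e1 e2) v' t'"
    then show "v' = v \<and> t' = s + t + 1"
      by cases (use Cond_false val.inject(1) in metis)+
  qed
next
  case (Bind env e1 u s e2 v t)
  show ?case
  proof (intro allI impI)
    fix v' t'
    assume "eval P env (Bind e1 e2) v' t'"
    then show "v' = v \<and> t' = s + t + 1"
      by cases (use Bind in metis)
  qed
next
  case (Call env es vs s g v t)
  show ?case
  proof (intro allI impI)
    fix v' t'
    assume "eval P env (Call g es) v' t'"
    then show "v' = v \<and> t' = s + t + 1"
      by cases (use Call in metis)
  qed
next
  case (Evals_Nil env)
  then show ?case by (auto elim: evals.cases)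
next
  case (Evals_Cons env e v s es vs t)
  show ?case
  proof (intro allI impI)
    fix vs' t'
    assume "evals P env (e # es) vs' t'"
    then show "vs' = v # vs \<and> t' = s + t"
      by cases (use Evals_Cons in metis)
  qed
qed

definition computes :: "program \<Rightarrow> val list \<Rightarrow> val \<Rightarrow> nat \<Rightarrow> bool" where
  "computes P args v t \<longleftrightarrow> P \<noteq> [] \<and> eval P args (hd P) v t"


section \<open>Approximation algorithms for the evaluation problem\<close>

fun list_val :: "val list \<Rightarrow> val" where
  "list_val [] = EmptyV"
| "list_val (v # vs) = PairV v (list_val vs)"

fun formula_val :: "formula \<Rightarrow> val" where
  "formula_val (Leaf i) = PairV (NatV 0) (NatV i)"
| "formula_val (And fs) = PairV (NatV 1) (list_val (map formula_val fs))"
| "formula_val (Or fs) = PairV (NatV 2) (list_val (map formula_val fs))"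

definition instance_args :: "nat \<Rightarrow> formula \<Rightarrow> (nat \<Rightarrow> real) \<Rightarrow> (nat \<Rightarrow> nat) \<Rightarrow> val list" where
  "instance_args n \<phi> p c =
     [NatV n, formula_val \<phi>,
      list_val (map (\<lambda>i. RealV (p i)) [0..<n]), list_val (map (\<lambda>i. NatV (c i)) [0..<n])]"

definition approximates_within ::
    "real \<Rightarrow> program \<Rightarrow> nat \<Rightarrow> formula \<Rightarrow> (nat \<Rightarrow> real) \<Rightarrow> (nat \<Rightarrow> nat) \<Rightarrow> nat \<Rightarrow> bool" where
  "approximates_within \<alpha> P n \<phi> p c T \<longleftrightarrow>
     (\<exists>\<pi> t. computes P (instance_args n \<phi> p c) (list_val (map NatV \<pi>)) t \<and> t \<le> T \<and>
        \<pi> \<in> permutations_of_set {..<n} \<and>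
        expected_cost n \<phi> p c \<pi> \<le> \<alpha> * optimal_cost n \<phi> p c)"

text \<open>Bivariate polynomials are polynomials in the second variable with coefficients that are
  polynomials in the first.\<close>

definition poly2 :: "nat poly poly \<Rightarrow> nat \<Rightarrow> nat \<Rightarrow> nat" where
  "poly2 q x y = poly (poly q [:y:]) x"

end

theory Submission
  imports Defs
begin

text \<open>
  A set of tests determines a read-once formula iff the outcomes contain a certificate for the value
  true or one for the value false. For each of the two values, the largest probability of a
  certificate within a given budget is found by dynamic programming over the tree: certificates of
  the children combine as \<open>x * y\<close> or \<open>x + y - x * y\<close> by independence, so that it suffices to
  distribute the budget over the children. In phase \<open>k\<close> the algorithm performs an optimal set of
  tests for each of the two values with budget \<open>2 ^ k\<close>. The phase costs at most \<open>2 * 2 ^ k\<close>, and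
  it leaves the formula undetermined with at most the probability that the optimal permutation costs
  more than \<open>2 ^ k\<close>. If that permutation costs \<open>T\<close>, summing
  \<open>2 + (\<Sum>k. 2 * 2 ^ (k + 1) * of_bool (2 ^ k < T)) \<le> 8 * T\<close> gives the factor 8.
\<close>

section \<open>Evaluation of programs\<close>

text \<open>The probability that a set of tests decides the formula is a sum of two objectives, one
  per value, which in general have different optimal sets; maximizing the sum over the tree would
  mean tracking trade-offs between the two. Maximizing each alone needs one number per budget, at
  the price of two sets of tests per phase. The factor is thus \<open>2 * 2 * 2\<close>: two sets
  per phase, the geometric sum over the phases, and overshooting the cost of the optimum by at most
  one doubling. A phase beats the optimal permutation only in probability, not on each assignment.
  Therefore both costs are bounded pointwise through indicators of failure at each budget, and these
  are compared budget by budget in expectation. One table entry for every budget up to the total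
  cost makes the time pseudo-polynomial; with unit costs that total is \<open>n\<close>.\<close>

definition wp :: "program \<Rightarrow> val list \<Rightarrow> exp \<Rightarrow> (val \<Rightarrow> nat \<Rightarrow> bool) \<Rightarrow> bool" where
  "wp P env e Q \<longleftrightarrow> (\<exists>v t. eval P env e v t \<and> Q v t)"

definition wps :: "program \<Rightarrow> val list \<Rightarrow> exp list \<Rightarrow> (val list \<Rightarrow> nat \<Rightarrow> bool) \<Rightarrow> bool" where
  "wps P env es Q \<longleftrightarrow> (\<exists>vs t. evals P env es vs t \<and> Q vs t)"

text \<open>Stated as equivalences, these rules let simplification execute a function body
  symbolically while it accumulates the step count. Execution halts at the bodies of called
  functions, where \<open>wp_eval\<close> takes over.\<close>

lemma wp_Ref [simp]: "wp P env (Ref i) Q \<longleftrightarrow> i < length env \<and> Q (env ! i) 1"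
proof
  assume "wp P env (Ref i) Q"
  then obtain v t where e: "eval P env (Ref i) v t" and Q: "Q v t"
    unfolding wp_def by blast
  from e show "i < length env \<and> Q (env ! i) 1"
    by cases (use Q in auto)
qed (unfold wp_def, blast intro: eval_evals.Ref)

lemma wp_Prim [simp]:
  "wp P env (Prim f es) Q \<longleftrightarrow> wps P env es (\<lambda>vs t. \<exists>v. prim_sem f vs v \<and> Q v (t + 1))"
proof
  assume "wp P env (Prim f es) Q"
  then obtain v t where e: "eval P env (Prim f es) v t" and Q: "Q v t"
    unfolding wp_def by blast
  from e show "wps P env es (\<lambda>vs t. \<exists>v. prim_sem f vs v \<and> Q v (t + 1))"
    by cases (use Q in \<open>auto simp: wps_def\<close>)
qed (unfold wp_def wps_def, blast intro: eval_evals.Prim)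

lemma wp_Cond [simp]:
  "wp P env (Cond b e1 e2) Q \<longleftrightarrow>
     wp P env b (\<lambda>u s. \<exists>k. u = NatV k \<and>
       (if k \<noteq> 0 then wp P env e1 (\<lambda>v t. Q v (s + t + 1)) else wp P env e2 (\<lambda>v t. Q v (s + t + 1))))"
proof
  assume "wp P env (Cond b e1 e2) Q"
  then obtain v t where e: "eval P env (Cond b e1 e2) v t" and Q: "Q v t"
    unfolding wp_def by blast
  from e show "wp P env b (\<lambda>u s. \<exists>k. u = NatV k \<and>
       (if k \<noteq> 0 then wp P env e1 (\<lambda>v t. Q v (s + t + 1)) else wp P env e2 (\<lambda>v t. Q v (s + t + 1))))"
    by cases (use Q in \<open>force simp: wp_def\<close>)+
next
  assume "wp P env b (\<lambda>u s. \<exists>k. u = NatV k \<and>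
       (if k \<noteq> 0 then wp P env e1 (\<lambda>v t. Q v (s + t + 1)) else wp P env e2 (\<lambda>v t. Q v (s + t + 1))))"
  then obtain k s where "eval P env b (NatV k) s"
    "if k \<noteq> 0 then wp P env e1 (\<lambda>v t. Q v (s + t + 1)) else wp P env e2 (\<lambda>v t. Q v (s + t + 1))"
    unfolding wp_def by blast
  then show "wp P env (Cond b e1 e2) Q"
    unfolding wp_def by (cases "k = 0") (use Cond_true Cond_false in fastforce)+
qed

lemma wp_Bind [simp]:
  "wp P env (exp.Bind e1 e2) Q \<longleftrightarrow>
     wp P env e1 (\<lambda>u s. wp P (u # env) e2 (\<lambda>v t. Q v (s + t + 1)))"
proof
  assume "wp P env (exp.Bind e1 e2) Q"
  then obtain v t where e: "eval P env (exp.Bind e1 e2) v t" and Q: "Q v t"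
    unfolding wp_def by blast
  from e show "wp P env e1 (\<lambda>u s. wp P (u # env) e2 (\<lambda>v t. Q v (s + t + 1)))"
    by cases (use Q in \<open>auto simp: wp_def\<close>)
qed (unfold wp_def, blast intro: eval_evals.Bind)

lemma wp_Call [simp]:
  "wp P env (Call g es) Q \<longleftrightarrow>
     wps P env es (\<lambda>vs s. g < length P \<and> wp P vs (P ! g) (\<lambda>v t. Q v (s + t + 1)))"
proof
  assume "wp P env (Call g es) Q"
  then obtain v t where e: "eval P env (Call g es) v t" and Q: "Q v t"
    unfolding wp_def by blast
  from e show "wps P env es (\<lambda>vs s. g < length P \<and> wp P vs (P ! g) (\<lambda>v t. Q v (s + t + 1)))"
    by cases (use Q in \<open>auto simp: wp_def wps_def\<close>)
qed (unfold wp_def wps_def, blast intro: eval_evals.Call)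

lemma wps_Nil [simp]: "wps P env [] Q \<longleftrightarrow> Q [] 0"
  unfolding wps_def by (auto elim: evals.cases intro: Evals_Nil)

lemma wps_Cons [simp]:
  "wps P env (e # es) Q \<longleftrightarrow> wp P env e (\<lambda>v s. wps P env es (\<lambda>vs t. Q (v # vs) (s + t)))"
proof
  assume "wps P env (e # es) Q"
  then obtain vs t where e: "evals P env (e # es) vs t" and Q: "Q vs t"
    unfolding wps_def by blast
  from e show "wp P env e (\<lambda>v s. wps P env es (\<lambda>vs t. Q (v # vs) (s + t)))"
    by cases (use Q in \<open>auto simp: wp_def wps_def\<close>)
qed (unfold wp_def wps_def, blast intro: Evals_Cons)

text \<open>Determinism turns one known run into an equation for every postcondition. The quantifier
  lies inside the proposition so that a run obtained from an induction hypothesis acts as a rewrite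
  rule.\<close>

lemma wp_eval: "eval P env e v t \<Longrightarrow> \<forall>Q. wp P env e Q \<longleftrightarrow> Q v t"
  unfolding wp_def using eval_deterministic(1) by blast

lemma prim_sem_simps [simp]:
  "prim_sem (MkNat k) [] v \<longleftrightarrow> v = NatV k"
  "prim_sem MkEmpty [] v \<longleftrightarrow> v = EmptyV"
  "prim_sem MkPair [a, b] v \<longleftrightarrow> v = PairV a b"
  "prim_sem First [PairV a b] v \<longleftrightarrow> v = a"
  "prim_sem Second [PairV a b] v \<longleftrightarrow> v = b"
  "prim_sem IsPair [EmptyV] v \<longleftrightarrow> v = NatV 0"
  "prim_sem IsPair [PairV a b] v \<longleftrightarrow> v = NatV 1"
  "prim_sem Add [NatV k, NatV l] v \<longleftrightarrow> v = NatV (k + l)"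
  "prim_sem Sub [NatV k, NatV l] v \<longleftrightarrow> v = NatV (k - l)"
  "prim_sem Less [NatV k, NatV l] v \<longleftrightarrow> v = NatV (if k < l then 1 else 0)"
  "prim_sem Add [RealV x, RealV y] v \<longleftrightarrow> v = RealV (x + y)"
  "prim_sem Sub [RealV x, RealV y] v \<longleftrightarrow> v = RealV (x - y)"
  "prim_sem Mult [RealV x, RealV y] v \<longleftrightarrow> v = RealV (x * y)"
  "prim_sem Less [RealV x, RealV y] v \<longleftrightarrow> v = NatV (if x < y then 1 else 0)"
  "prim_sem ToReal [NatV k] v \<longleftrightarrow> v = RealV (real k)"
  by (auto elim: prim_sem.cases simp: prim_sem.simps)

abbreviation (input) "nat_e k \<equiv> Prim (MkNat k) []"
abbreviation (input) "nil_e \<equiv> Prim MkEmpty []"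
abbreviation (input) "cons_e a b \<equiv> Prim MkPair [a, b]"
abbreviation (input) "hd_e a \<equiv> Prim First [a]"
abbreviation (input) "tl_e a \<equiv> Prim Second [a]"
abbreviation (input) "ispair_e a \<equiv> Prim IsPair [a]"
abbreviation (input) "add_e a b \<equiv> Prim Add [a, b]"
abbreviation (input) "sub_e a b \<equiv> Prim Sub [a, b]"
abbreviation (input) "mult_e a b \<equiv> Prim Mult [a, b]"
abbreviation (input) "less_e a b \<equiv> Prim Less [a, b]"
abbreviation (input) "real_e a \<equiv> Prim ToReal [a]"
text \<open>Truncated subtraction in both directions gives the distance. As a condition it replaces
  an equality test, being \<open>0\<close> exactly for equal numbers.\<close>

abbreviation (input) "diff_e a b \<equiv> add_e (sub_e a b) (sub_e b a)"

section \<open>The program as a list of function bodies\<close>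

abbreviation (input) "append_f \<equiv> Suc 0"
abbreviation (input) "nth_f \<equiv> 2 :: nat"
abbreviation (input) "sum_f \<equiv> 3 :: nat"
abbreviation (input) "step_table_f \<equiv> 4 :: nat"
abbreviation (input) "best_f \<equiv> 5 :: nat"
abbreviation (input) "conv_f \<equiv> 6 :: nat"
abbreviation (input) "table_f \<equiv> 7 :: nat"
abbreviation (input) "tables_f \<equiv> 8 :: nat"
abbreviation (input) "compl_f \<equiv> 9 :: nat"
abbreviation (input) "phases_f \<equiv> 10 :: nat"
abbreviation (input) "upto_f \<equiv> 11 :: nat"
abbreviation (input) "member_f \<equiv> 12 :: nat"
abbreviation (input) "nub_f \<equiv> 13 :: nat"

text \<open>The same table functions serve both values: their first argument is the tag of the node
  type that acts as conjunction, \<open>1\<close> for \<open>And\<close> when certifying true and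
  \<open>2\<close> for \<open>Or\<close> when certifying false, and the leaf weights are
  complemented in the second case. Each \<open>Bind\<close> shifts all earlier references by
  one.\<close>

definition prog :: program where
  "prog =
   [\<comment> \<open>main: \<open>n\<close>, formula, probabilities, costs\<close>
    exp.Bind (Call sum_f [Ref 3])
      (Call nub_f
        [Call phases_f
          [nat_e 1, Ref 0,
           Call table_f [nat_e 1, Ref 3, Ref 4, Ref 0, Ref 2],
           Call table_f [nat_e 2, Call compl_f [Ref 3], Ref 4, Ref 0, Ref 2],
           Call upto_f [nat_e 0, Ref 1]],
         nil_e]),
    \<comment> \<open>append: \<open>xs\<close>, \<open>ys\<close>\<close>
    Cond (ispair_e (Ref 0))
      (cons_e (hd_e (Ref 0)) (Call append_f [tl_e (Ref 0), Ref 1]))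
      (Ref 1),
    \<comment> \<open>nth: \<open>xs\<close>, \<open>i\<close>\<close>
    Cond (Ref 1)
      (Call nth_f [tl_e (Ref 0), sub_e (Ref 1) (nat_e 1)])
      (hd_e (Ref 0)),
    \<comment> \<open>sum: \<open>xs\<close>\<close>
    Cond (ispair_e (Ref 0))
      (add_e (hd_e (Ref 0)) (Call sum_f [tl_e (Ref 0)]))
      (nat_e 0),
    \<comment> \<open>step table: threshold, first budget, last budget, upper entry, lower entry\<close>
    Cond (less_e (Ref 2) (Ref 1))
      nil_e
      (cons_e (Cond (less_e (Ref 1) (Ref 0)) (Ref 4) (Ref 3))
        (Call step_table_f [Ref 0, add_e (Ref 1) (nat_e 1), Ref 2, Ref 3, Ref 4])),
    \<comment> \<open>best: conjunction flag, entries, entries, best entry so far\<close>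
    Cond (ispair_e (Ref 1))
      (exp.Bind
        (Cond (Ref 0)
          (mult_e (hd_e (hd_e (Ref 1))) (hd_e (hd_e (Ref 2))))
          (sub_e (add_e (hd_e (hd_e (Ref 1))) (hd_e (hd_e (Ref 2))))
            (mult_e (hd_e (hd_e (Ref 1))) (hd_e (hd_e (Ref 2))))))
        (Call best_f
          [Ref 1, tl_e (Ref 2), tl_e (Ref 3),
           Cond (less_e (hd_e (Ref 4)) (Ref 0))
             (cons_e (Ref 0) (Call append_f [tl_e (hd_e (Ref 2)), tl_e (hd_e (Ref 3))]))
             (Ref 4)]))
      (Ref 3),
    \<comment> \<open>convolution: conjunction flag, rest of first table, its reversed beginning, second table\<close>
    Cond (ispair_e (Ref 1))
      (exp.Bind (cons_e (hd_e (Ref 1)) (Ref 2))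
        (cons_e
          (Call best_f [Ref 1, Ref 0, Ref 4, cons_e (real_e (nat_e 0)) nil_e])
          (Call conv_f [Ref 1, tl_e (Ref 2), Ref 0, Ref 4])))
      nil_e,
    \<comment> \<open>table: tag of conjunctions, leaf weights, costs, last budget, formula\<close>
    Cond (hd_e (Ref 4))
      (Call tables_f
        [Ref 0, Ref 1, Ref 2, Ref 3, sub_e (nat_e 1) (diff_e (hd_e (Ref 4)) (Ref 0)), tl_e (Ref 4)])
      (Call step_table_f
        [Call nth_f [Ref 2, tl_e (Ref 4)], nat_e 0, Ref 3,
         cons_e (Call nth_f [Ref 1, tl_e (Ref 4)]) (cons_e (tl_e (Ref 4)) nil_e),
         cons_e (real_e (nat_e 0)) nil_e]),
    \<comment> \<open>tables: tag of conjunctions, leaf weights, costs, last budget, conjunction flag, formulas\<close>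
    Cond (ispair_e (Ref 5))
      (Call conv_f
        [Ref 4, Call table_f [Ref 0, Ref 1, Ref 2, Ref 3, hd_e (Ref 5)], nil_e,
         Call tables_f [Ref 0, Ref 1, Ref 2, Ref 3, Ref 4, tl_e (Ref 5)]])
      (exp.Bind (cons_e (real_e (Ref 4)) nil_e)
        (Call step_table_f [nat_e 0, nat_e 0, Ref 4, Ref 0, Ref 0])),
    \<comment> \<open>complementary probabilities: \<open>ps\<close>\<close>
    Cond (ispair_e (Ref 0))
      (cons_e (sub_e (real_e (nat_e 1)) (hd_e (Ref 0))) (Call compl_f [tl_e (Ref 0)]))
      nil_e,
    \<comment> \<open>phases: budget, last budget, table, table, final tests\<close>
    Cond (less_e (Ref 1) (Ref 0))
      (Ref 4)
      (Call append_f
        [tl_e (Call nth_f [Ref 2, Ref 0]),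
         Call append_f
          [tl_e (Call nth_f [Ref 3, Ref 0]),
           Call phases_f [add_e (Ref 0) (Ref 0), Ref 1, Ref 2, Ref 3, Ref 4]]]),
    \<comment> \<open>upto: first, bound\<close>
    Cond (less_e (Ref 0) (Ref 1))
      (cons_e (Ref 0) (Call upto_f [add_e (Ref 0) (nat_e 1), Ref 1]))
      nil_e,
    \<comment> \<open>member: \<open>x\<close>, \<open>xs\<close>\<close>
    Cond (ispair_e (Ref 1))
      (Cond (diff_e (Ref 0) (hd_e (Ref 1)))
        (Call member_f [Ref 0, tl_e (Ref 1)])
        (nat_e 1))
      (nat_e 0),
    \<comment> \<open>nub: \<open>xs\<close>, elements seen so far\<close>
    Cond (ispair_e (Ref 0))
      (Cond (Call member_f [hd_e (Ref 0), Ref 1])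
        (Call nub_f [tl_e (Ref 0), Ref 1])
        (cons_e (hd_e (Ref 0)) (Call nub_f [tl_e (Ref 0), cons_e (hd_e (Ref 0)) (Ref 1)])))
      nil_e]"

definition runs :: "nat \<Rightarrow> val list \<Rightarrow> val \<Rightarrow> nat \<Rightarrow> bool" where
  "runs g vs v T \<longleftrightarrow> (\<exists>t\<le>T. eval prog vs (prog ! g) v t)"

lemma length_prog [simp]: "length prog = 14"
  by (simp add: prog_def)

lemma runsI: "prog ! g = e \<Longrightarrow> wp prog vs e (\<lambda>u t. u = v \<and> t \<le> T) \<Longrightarrow> runs g vs v T"
  by (auto simp: runs_def wp_def)

abbreviation nats_val :: "nat list \<Rightarrow> val" where
  "nats_val xs \<equiv> list_val (map NatV xs)"

text \<open>The pattern of all timing lemmas: the recursive run comes from the induction hypothesis,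
  the body is executed symbolically, and the constant is generous. The recursion consumes only the
  first list, so the time is independent of \<open>ys\<close>; later bounds rely on this.\<close>

lemma runs_append: "runs append_f [list_val xs, list_val ys] (list_val (xs @ ys)) (20 * Suc (length xs))"
proof (induction xs)
  case Nil
  show ?case by (rule runsI, simp add: prog_def, simp)
next
  case (Cons x xs)
  from Cons.IH obtain t where t: "t \<le> 20 * Suc (length xs)"
    "eval prog [list_val xs, list_val ys] (prog ! append_f) (list_val (xs @ ys)) t"
    by (auto simp: runs_def)
  show ?case
    by (rule runsI, simp add: prog_def, use t(1) wp_eval[OF t(2)] in simp)
qed

section \<open>Optimal certificates by dynamic programming\<close>

type_synonym entry = "real \<times> nat list"

definition combine :: "bool \<Rightarrow> real \<Rightarrow> real \<Rightarrow> real" where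
  "combine a x y = (if a then x * y else x + y - x * y)"

lemma combine_bounds:
  assumes "0 \<le> x" "x \<le> 1" "0 \<le> y" "y \<le> 1"
  shows "0 \<le> combine a x y" "combine a x y \<le> 1"
proof -
  have "0 \<le> (1 - x) * (1 - y)" "0 \<le> x * (1 - y)" "x * y \<le> 1"
    using assms by (auto intro: mult_le_one)
  then show "0 \<le> combine a x y" "combine a x y \<le> 1"
    using assms by (auto simp: combine_def algebra_simps)
qed

lemma combine_mono:
  assumes "0 \<le> x" "x \<le> x'" "x' \<le> 1" "0 \<le> y" "y \<le> y'" "y' \<le> 1"
  shows "combine a x y \<le> combine a x' y'"
proof (cases a)
  case True
  then show ?thesis
    using assms by (simp add: combine_def mult_mono)
next
  case False
  \<comment> \<open>The disjunctive combination is \<open>1 - (1 - x) * (1 - y)\<close>, so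
    monotonicity is that of a product of complements.\<close>
  have "(1 - x') * (1 - y') \<le> (1 - x) * (1 - y)"
    using assms by (intro mult_mono) auto
  then show ?thesis
    using False by (simp add: combine_def algebra_simps)
qed

fun combine_all :: "bool \<Rightarrow> real list \<Rightarrow> real" where
  "combine_all a [] = of_bool a"
| "combine_all a (x # xs) = combine a x (combine_all a xs)"

lemma combine_all_bounds:
  "\<forall>x\<in>set xs. 0 \<le> x \<and> x \<le> 1 \<Longrightarrow> 0 \<le> combine_all a xs \<and> combine_all a xs \<le> 1"
  by (induction xs) (auto intro: combine_bounds)

lemma combine_all_mono:
  assumes "\<forall>x\<in>set xs. 0 \<le> f x \<and> f x \<le> g x \<and> g x \<le> 1"
  shows "combine_all a (map f xs) \<le> combine_all a (map g xs)"
  using assms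
proof (induction xs)
  case (Cons x xs)
  have "\<forall>y\<in>set (map f xs). 0 \<le> y \<and> y \<le> 1" "\<forall>y\<in>set (map g xs). 0 \<le> y \<and> y \<le> 1"
    using Cons.prems by force+
  from this[THEN combine_all_bounds] show ?case
    using Cons by (auto intro!: combine_mono)
qed simp

text \<open>For \<open>a = True\<close>, \<open>certainty a w \<phi>\<close> is the probability that \<open>\<phi>\<close> is true when the leaves are
  independently true with probabilities \<open>w\<close>; for \<open>a = False\<close>, the roles of truth and falsity, and
  hence those of \<open>And\<close> and \<open>Or\<close>, are exchanged.\<close>

fun certainty :: "bool \<Rightarrow> (nat \<Rightarrow> real) \<Rightarrow> formula \<Rightarrow> real" where
  "certainty a w (Leaf i) = w i"
| "certainty a w (And fs) = combine_all a (map (certainty a w) fs)"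
| "certainty a w (Or fs) = combine_all (\<not> a) (map (certainty a w) fs)"

lemma certainty_bounds:
  "\<forall>i. 0 \<le> w i \<and> w i \<le> 1 \<Longrightarrow> 0 \<le> certainty a w \<phi> \<and> certainty a w \<phi> \<le> 1"
  by (induction \<phi>) (auto intro!: combine_all_bounds)

lemma certainty_mono:
  assumes "\<forall>i. 0 \<le> w i \<and> w i \<le> w' i \<and> w' i \<le> 1"
  shows "certainty a w \<phi> \<le> certainty a w' \<phi>"
proof -
  have "\<forall>i. 0 \<le> w i \<and> w i \<le> 1" "\<forall>i. 0 \<le> w' i \<and> w' i \<le> 1"
    using assms by (meson order_trans)+
  note b = this[THEN certainty_bounds]
  show ?thesis
    using assms by (induction \<phi>) (auto intro!: combine_all_mono simp: b)
qed

text \<open>Weight \<open>0\<close> expresses that a test outside \<open>S\<close> can never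
  contribute to a certificate. Sets of tests thus enter \<open>certainty\<close> through the weights
  alone.\<close>

definition restrict_weights :: "(nat \<Rightarrow> real) \<Rightarrow> nat set \<Rightarrow> nat \<Rightarrow> real" where
  "restrict_weights q S i = (if i \<in> S then q i else 0)"

fun best :: "bool \<Rightarrow> entry list \<Rightarrow> entry list \<Rightarrow> entry \<Rightarrow> entry" where
  "best a (x # xs) (y # ys) e =
     best a xs ys
       (let v = combine a (fst x) (fst y) in if fst e < v then (v, snd x @ snd y) else e)"
| "best a _ _ e = e"

text \<open>Splitting a budget \<open>b\<close> into \<open>b - i\<close> and \<open>i\<close> pairs
  a reversed prefix of one table with the other table position by position. Accumulating that prefix
  in \<open>rs\<close> avoids indexed access, which is not constant time on cons cells.\<close>

fun convolution :: "bool \<Rightarrow> entry list \<Rightarrow> entry list \<Rightarrow> entry list \<Rightarrow> entry list" where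
  "convolution a [] rs ys = []"
| "convolution a (x # xs) rs ys = best a (x # rs) ys (0, []) # convolution a xs (x # rs) ys"

definition step_table :: "nat \<Rightarrow> nat \<Rightarrow> nat \<Rightarrow> 'a \<Rightarrow> 'a \<Rightarrow> 'a list" where
  "step_table k b C hi lo = map (\<lambda>j. if j < k then lo else hi) [b..<Suc C]"

fun convolutions :: "nat \<Rightarrow> bool \<Rightarrow> entry list list \<Rightarrow> entry list" where
  "convolutions C a [] = step_table 0 0 C (of_bool a, []) (of_bool a, [])"
| "convolutions C a (T # Ts) = convolution a T [] (convolutions C a Ts)"

fun table :: "bool \<Rightarrow> (nat \<Rightarrow> real) \<Rightarrow> (nat \<Rightarrow> nat) \<Rightarrow> nat \<Rightarrow> formula \<Rightarrow> entry list" where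
  "table a q c C (Leaf i) = step_table (c i) 0 C (q i, [i]) (0, [])"
| "table a q c C (And fs) = convolutions C a (map (table a q c C) fs)"
| "table a q c C (Or fs) = convolutions C (\<not> a) (map (table a q c C) fs)"

text \<open>Together with \<open>best_start\<close> and \<open>best_upper\<close>, this
  characterizes \<open>best\<close> as a maximum with a witness.\<close>

lemma best_cases:
  "best a xs ys e = e \<or>
   (\<exists>i<length xs. i < length ys \<and>
     best a xs ys e = (combine a (fst (xs ! i)) (fst (ys ! i)), snd (xs ! i) @ snd (ys ! i)))"
proof (induction a xs ys e rule: best.induct)
  case (1 a x xs y ys e)
  let ?v = "combine a (fst x) (fst y)"
  let ?e = "let v = combine a (fst x) (fst y) in if fst e < v then (v, snd x @ snd y) else e"
  from "1.IH" consider "best a xs ys ?e = ?e"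
    | i where "i < length xs" "i < length ys"
      "best a xs ys ?e = (combine a (fst (xs ! i)) (fst (ys ! i)), snd (xs ! i) @ snd (ys ! i))"
    by blast
  then show ?case
  proof cases
    case 1
    then show ?thesis
      by (cases "fst e < ?v") (force simp: Let_def)+
  next
    case (2 i)
    then show ?thesis
      by (intro disjI2 exI[of _ "Suc i"]) simp
  qed
qed auto

lemma best_start: "fst e \<le> fst (best a xs ys e)"
proof (induction a xs ys e rule: best.induct)
  case (1 a x xs y ys e)
  then show ?case
    by (auto simp: Let_def split: if_splits)
qed auto

lemma best_upper:
  "i < length xs \<Longrightarrow> i < length ys \<Longrightarrow>
   combine a (fst (xs ! i)) (fst (ys ! i)) \<le> fst (best a xs ys e)"
proof (induction a xs ys e arbitrary: i rule: best.induct)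
  case (1 a x xs y ys e)
  let ?v = "combine a (fst x) (fst y)"
  let ?e = "let v = combine a (fst x) (fst y) in if fst e < v then (v, snd x @ snd y) else e"
  show ?case
  proof (cases i)
    case 0
    have "?v \<le> fst ?e"
      by (simp add: Let_def)
    also have "\<dots> \<le> fst (best a xs ys ?e)"
      by (rule best_start)
    finally show ?thesis
      using 0 by simp
  next
    case (Suc j)
    then show ?thesis
      using "1.IH"[of j] "1.prems" by simp
  qed
qed auto

lemma length_convolution [simp]: "length (convolution a xs rs ys) = length xs"
  by (induction a xs rs ys rule: convolution.induct) auto

lemma nth_convolution:
  "j < length xs \<Longrightarrow>
   convolution a xs rs ys ! j = best a (rev (take (Suc j) xs) @ rs) ys (0, [])"
proof (induction a xs rs ys arbitrary: j rule: convolution.induct)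
  case (2 a x xs rs ys)
  then show ?case
    by (cases j) auto
qed simp

text \<open>The competing sets \<open>S\<close> are not restricted to \<open>L\<close>, but only their elements in \<open>L\<close> are paid
  for. This spares the restriction of \<open>S\<close> to the leaves of a child.\<close>

definition optimal_table ::
    "nat \<Rightarrow> (nat \<Rightarrow> nat) \<Rightarrow> nat \<Rightarrow> (nat set \<Rightarrow> real) \<Rightarrow> nat set \<Rightarrow> entry list \<Rightarrow> bool" where
  "optimal_table n c C F L T \<longleftrightarrow> length T = Suc C \<and>
     (\<forall>b\<le>C. 0 \<le> fst (T ! b) \<and> fst (T ! b) \<le> F (set (snd (T ! b))) \<and>
        set (snd (T ! b)) \<subseteq> {..<n} \<and> (\<Sum>i\<leftarrow>snd (T ! b). c i) \<le> b \<and>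
        (\<forall>S. (\<Sum>i\<in>S \<inter> L. c i) \<le> b \<longrightarrow> F S \<le> fst (T ! b)))"

text \<open>The stored value need only be a lower bound for its stored set: joining the sets of two
  children can only raise \<open>F\<close> and \<open>G\<close>, by monotonicity. Conversely,
  disjointness of \<open>L\<close> and \<open>K\<close> splits the cost of a competing
  \<open>S\<close> into two shares, and each table already beats the whole of \<open>S\<close> at
  its share.\<close>

lemma optimal_table_convolution:
  assumes T: "optimal_table n c C F L T" and U: "optimal_table n c C G K U"
    and fin: "finite L" "finite K" and disj: "L \<inter> K = {}"
    and F: "mono F" "\<And>S. 0 \<le> F S" "\<And>S. F S \<le> 1"
    and G: "mono G" "\<And>S. 0 \<le> G S" "\<And>S. G S \<le> 1"
  shows "optimal_table n c C (\<lambda>S. combine a (F S) (G S)) (L \<union> K) (convolution a T [] U)"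
  unfolding optimal_table_def
proof (intro conjI allI impI)
  have len: "length T = Suc C" "length U = Suc C"
    using T U by (auto simp: optimal_table_def)
  then show "length (convolution a T [] U) = Suc C"
    by simp
  fix b
  assume b: "b \<le> C"
  define r where "r = convolution a T [] U ! b"
  have r: "r = best a (rev (take (Suc b) T)) U (0, [])"
    using b len by (simp add: r_def nth_convolution)
  have nth: "rev (take (Suc b) T) ! i = T ! (b - i)" if "i \<le> b" for i
    using that b len by (subst rev_nth) auto
  have T': "0 \<le> fst (T ! k)" "fst (T ! k) \<le> F (set (snd (T ! k)))" "set (snd (T ! k)) \<subseteq> {..<n}"
      "(\<Sum>i\<leftarrow>snd (T ! k). c i) \<le> k" if "k \<le> C" for k
    using T that by (auto simp: optimal_table_def)
  have U': "0 \<le> fst (U ! k)" "fst (U ! k) \<le> G (set (snd (U ! k)))" "set (snd (U ! k)) \<subseteq> {..<n}"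
      "(\<Sum>i\<leftarrow>snd (U ! k). c i) \<le> k" if "k \<le> C" for k
    using U that by (auto simp: optimal_table_def)
  show "0 \<le> fst (convolution a T [] U ! b)"
    using best_start[of "(0, [])"] by (simp add: r r_def[symmetric])
  from best_cases[of a "rev (take (Suc b) T)" U "(0, [])"] consider "r = (0, [])"
    | i where "i \<le> b"
      "r = (combine a (fst (T ! (b - i))) (fst (U ! i)), snd (T ! (b - i)) @ snd (U ! i))"
    using len b by (auto simp: r[symmetric] nth less_Suc_eq_le)
  then have "fst r \<le> combine a (F (set (snd r))) (G (set (snd r))) \<and>
    set (snd r) \<subseteq> {..<n} \<and> (\<Sum>i\<leftarrow>snd r. c i) \<le> b"
  proof cases
    case 1
    then show ?thesis
      using combine_bounds(1)[OF F(2,3) G(2,3)] by simp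
  next
    case (2 i)
    have i: "b - i \<le> C" "i \<le> C"
      using b 2(1) by auto
    let ?S = "set (snd (T ! (b - i)))" and ?S' = "set (snd (U ! i))"
    have "fst (T ! (b - i)) \<le> F (?S \<union> ?S')"
      using T'(2)[OF i(1)] monoD[OF F(1), of ?S "?S \<union> ?S'"] by simp
    moreover have "fst (U ! i) \<le> G (?S \<union> ?S')"
      using U'(2)[OF i(2)] monoD[OF G(1), of ?S' "?S \<union> ?S'"] by simp
    ultimately have "fst r \<le> combine a (F (?S \<union> ?S')) (G (?S \<union> ?S'))"
      using T'(1)[OF i(1)] U'(1)[OF i(2)] F(3) G(3) by (auto simp: 2(2) intro: combine_mono)
    then show ?thesis
      using T'(3,4)[OF i(1)] U'(3,4)[OF i(2)] 2 by auto
  qed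
  then show "fst (convolution a T [] U ! b) \<le>
      combine a (F (set (snd (convolution a T [] U ! b)))) (G (set (snd (convolution a T [] U ! b))))"
    "set (snd (convolution a T [] U ! b)) \<subseteq> {..<n}"
    "(\<Sum>i\<leftarrow>snd (convolution a T [] U ! b). c i) \<le> b"
    by (simp_all add: r_def)
  fix S
  assume S: "(\<Sum>i\<in>S \<inter> (L \<union> K). c i) \<le> b"
  \<comment> \<open>The share of the budget that \<open>S\<close> spends on \<open>K\<close>; it
    names the pair of entries that beats \<open>S\<close>.\<close>
  define i where "i = (\<Sum>i\<in>S \<inter> K. c i)"
  have "(\<Sum>i\<in>S \<inter> (L \<union> K). c i) = (\<Sum>i\<in>S \<inter> L. c i) + i"
    unfolding i_def Int_Un_distrib using fin disj by (intro sum.union_disjoint) auto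
  then have i: "(\<Sum>i\<in>S \<inter> L. c i) \<le> b - i" "i \<le> b"
    using S by auto
  have "F S \<le> fst (T ! (b - i))"
    using T i b by (auto simp: optimal_table_def)
  moreover have "G S \<le> fst (U ! i)"
    using U i b by (auto simp: optimal_table_def i_def)
  moreover have "fst (T ! (b - i)) \<le> 1" "fst (U ! i) \<le> 1"
    using T'(2)[of "b - i"] U'(2)[of i] i b F(3) G(3) by (meson diff_le_self le_trans order_trans)+
  ultimately have "combine a (F S) (G S) \<le> combine a (fst (T ! (b - i))) (fst (U ! i))"
    using F(2) G(2) by (intro combine_mono) auto
  also have "\<dots> \<le> fst r"
    using best_upper[of i "rev (take (Suc b) T)" U a "(0, [])"] i b len
    by (simp add: nth r)
  finally show "combine a (F S) (G S) \<le> fst (convolution a T [] U ! b)"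
    by (simp add: r_def)
qed

lemma mono_certainty_restrict:
  assumes "\<And>i. 0 \<le> q i" "\<And>i. q i \<le> 1"
  shows "mono (\<lambda>S. certainty a (restrict_weights q S) \<phi>)"
  using assms by (intro monoI certainty_mono) (auto simp: restrict_weights_def)

lemma certainty_restrict_bounds:
  assumes "\<And>i. 0 \<le> q i" "\<And>i. q i \<le> 1"
  shows "0 \<le> certainty a (restrict_weights q S) \<phi>" "certainty a (restrict_weights q S) \<phi> \<le> 1"
  using certainty_bounds[of "restrict_weights q S" a \<phi>] assms by (auto simp: restrict_weights_def)

text \<open>Here \<open>d\<close> tells whether the node acts as a conjunction, while
  \<open>a\<close> is the value to be certified: \<open>And\<close> takes \<open>d = a\<close>, and
  \<open>Or\<close> takes the negation.\<close>

lemma optimal_table_convolutions: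
  assumes q: "\<And>i. 0 \<le> q i" "\<And>i. q i \<le> 1"
    and fs: "\<And>f. f \<in> set fs \<Longrightarrow> optimal_table n c C
      (\<lambda>S. certainty a (restrict_weights q S) f) (set (leaves f)) (table a q c C f)"
    and dist: "distinct (concat (map leaves fs))"
  shows "optimal_table n c C (\<lambda>S. combine_all d (map (certainty a (restrict_weights q S)) fs))
    (set (concat (map leaves fs))) (convolutions C d (map (table a q c C) fs))"
  using fs dist
proof (induction fs)
  case Nil
  show ?case
    by (auto simp: optimal_table_def step_table_def simp del: upt_Suc)
next
  case (Cons f fs)
  let ?G = "\<lambda>S. combine_all d (map (certainty a (restrict_weights q S)) fs)"
  have "mono ?G"
    using q by (intro monoI combine_all_mono ballI conjI certainty_restrict_bounds
      monoD[OF mono_certainty_restrict]) auto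
  moreover have "0 \<le> ?G S" "?G S \<le> 1" for S
    using certainty_restrict_bounds[of q] q
      combine_all_bounds[of "map (certainty a (restrict_weights q S)) fs" d] by auto
  moreover have "set (leaves f) \<inter> set (concat (map leaves fs)) = {}"
    using Cons.prems(2) by simp
  ultimately have "optimal_table n c C
    (\<lambda>S. combine d (certainty a (restrict_weights q S) f) (?G S))
    (set (leaves f) \<union> set (concat (map leaves fs)))
    (convolution d (table a q c C f) [] (convolutions C d (map (table a q c C) fs)))"
    using Cons q
    by (intro optimal_table_convolution mono_certainty_restrict certainty_restrict_bounds) auto
  then show ?case
    by simp
qed

lemma distinct_concat_mapD:
  "distinct (concat (map f xs)) \<Longrightarrow> x \<in> set xs \<Longrightarrow> distinct (f x)"
  by (induction xs) auto

lemma optimal_table_table: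
  assumes q: "\<And>i. 0 \<le> q i" "\<And>i. q i \<le> 1"
    and "distinct (leaves \<phi>)" "set (leaves \<phi>) \<subseteq> {..<n}"
  shows "optimal_table n c C (\<lambda>S. certainty a (restrict_weights q S) \<phi>) (set (leaves \<phi>))
    (table a q c C \<phi>)"
  using assms(3,4)
proof (induction \<phi>)
  case (Leaf i)
  then show ?case
    using q by (auto simp: optimal_table_def step_table_def restrict_weights_def simp del: upt_Suc)
next
  case (And fs)
  have "optimal_table n c C (\<lambda>S. certainty a (restrict_weights q S) f) (set (leaves f))
      (table a q c C f)" if "f \<in> set fs" for f
    using And that by (auto dest: distinct_concat_mapD)
  from optimal_table_convolutions[OF q this, of fs] show ?case
    using And.prems by simp
next
  case (Or fs)
  have "optimal_table n c C (\<lambda>S. certainty a (restrict_weights q S) f) (set (leaves f))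
      (table a q c C f)" if "f \<in> set fs" for f
    using Or that by (auto dest: distinct_concat_mapD)
  from optimal_table_convolutions[OF q this, of fs] show ?case
    using Or.prems by simp
qed

section \<open>Running time of the convolutions\<close>

lemma runs_nth:
  "i < length xs \<Longrightarrow> runs nth_f [list_val xs, NatV i] (xs ! i) (20 * Suc i)"
proof (induction i arbitrary: xs)
  case 0
  then obtain y ys where "xs = y # ys"
    by (cases xs) auto
  then show ?case
    by (intro runsI, simp add: prog_def, simp)
next
  case (Suc i)
  then obtain y ys where xs: "xs = y # ys" "i < length ys"
    by (cases xs) auto
  from Suc.IH[OF xs(2)] obtain t where t: "t \<le> 20 * Suc i"
    "eval prog [list_val ys, NatV i] (prog ! nth_f) (ys ! i) t"
    by (auto simp: runs_def)
  show ?case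
    by (rule runsI, simp add: prog_def, use t(1) wp_eval[OF t(2)] in \<open>simp add: xs\<close>)
qed

lemma runs_sum:
  "runs sum_f [nats_val xs] (NatV (sum_list xs)) (20 * Suc (length xs))"
proof (induction xs)
  case Nil
  show ?case by (rule runsI, simp add: prog_def, simp)
next
  case (Cons x xs)
  then obtain t where t: "t \<le> 20 * Suc (length xs)"
    "eval prog [nats_val xs] (prog ! sum_f) (NatV (sum_list xs)) t"
    by (auto simp: runs_def)
  show ?case
    by (rule runsI, simp add: prog_def, use t(1) wp_eval[OF t(2)] in simp)
qed

lemma runs_step_table:
  "runs step_table_f [NatV k, NatV b, NatV C, hi, lo] (list_val (step_table k b C hi lo))
     (30 * Suc (Suc C - b))"
proof (induction "Suc C - b" arbitrary: b)
  case 0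
  then have "C < b" by simp
  then show ?case
    by (intro runsI, simp add: prog_def, simp add: step_table_def)
next
  case (Suc m)
  then have b: "b \<le> C" by simp
  from Suc have "runs step_table_f [NatV k, NatV (Suc b), NatV C, hi, lo]
      (list_val (step_table k (Suc b) C hi lo)) (30 * Suc m)"
    using Suc.hyps(1)[of "Suc b"] by (metis Suc_diff_le diff_Suc_Suc b diff_Suc_1)
  then obtain t where t: "t \<le> 30 * Suc m"
    "eval prog [NatV k, NatV (Suc b), NatV C, hi, lo] (prog ! step_table_f) (list_val (step_table k (Suc b) C hi lo)) t"
    by (auto simp: runs_def)
  have "step_table k b C hi lo = (if b < k then lo else hi) # step_table k (Suc b) C hi lo"
    using b by (simp add: step_table_def upt_rec[of b] del: upt_Suc)
  then show ?case
    by (intro runsI, simp add: prog_def, use t(1) wp_eval[OF t(2)] b Suc.hyps(2)[symmetric] in simp)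
qed

fun entry_val :: "entry \<Rightarrow> val" where
  "entry_val (v, S) = PairV (RealV v) (nats_val S)"

abbreviation entries_val :: "entry list \<Rightarrow> val" where
  "entries_val T \<equiv> list_val (map entry_val T)"

text \<open>The program looks for the end of the first list only, hence the assumption on the
  lengths. Concatenation copies its first argument only, hence \<open>L\<close> bounds just the
  certificates in \<open>xs\<close>.\<close>

lemma runs_best:
  assumes "length xs \<le> length ys" "\<forall>x\<in>set xs. length (snd x) \<le> L"
  shows "runs best_f [NatV (of_bool a), entries_val xs, entries_val ys, entry_val e]
    (entry_val (best a xs ys e)) (100 * Suc L * Suc (length xs))"
  using assms
proof (induction xs arbitrary: ys e)
  case Nil
  show ?case by (rule runsI, simp add: prog_def, simp)
next
  case (Cons x xs)
  then obtain y zs where ys: "ys = y # zs"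
    by (cases ys) auto
  obtain v S w R u U where [simp]: "x = (v, S)" "y = (w, R)" "e = (u, U)"
    by (cases x, cases y, cases e)
  define e' where "e' = (if u < combine a v w then (combine a v w, S @ R) else e)"
  from Cons.IH[of zs e'] Cons.prems ys obtain t where t: "t \<le> 100 * Suc L * Suc (length xs)"
    "eval prog [NatV (of_bool a), entries_val xs, entries_val zs, entry_val e'] (prog ! best_f) (entry_val (best a xs zs e')) t"
    by (auto simp: runs_def)
  from runs_append[of "map NatV S" "map NatV R"] obtain s where s: "s \<le> 20 * Suc (length S)"
    "eval prog [nats_val S, nats_val R] (prog ! append_f) (nats_val (S @ R)) s"
    by (auto simp: runs_def)
  have "length S \<le> L"
    using Cons.prems by simp
  then have s': "s \<le> 20 * Suc L"
    using s(1) by simp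
  show ?case
    unfolding ys
    by (rule runsI, simp add: prog_def, cases a; cases "u < combine a v w")
      (use t(1) wp_eval[OF t(2)] wp_eval[OF s(2)] s' in \<open>simp_all add: combine_def e'_def\<close>)
qed

lemma runs_convolution:
  assumes "length xs + length rs \<le> length ys" "\<forall>x\<in>set (xs @ rs). length (snd x) \<le> L"
  shows "runs conv_f [NatV (of_bool a), entries_val xs, entries_val rs, entries_val ys]
    (entries_val (convolution a xs rs ys)) (200 * Suc L * Suc (length ys) * Suc (length xs))"
  using assms
proof (induction xs arbitrary: rs)
  case Nil
  show ?case by (rule runsI, simp add: prog_def, simp)
next
  case (Cons x xs)
  from Cons.IH[of "x # rs"] Cons.prems obtain t where
    t: "t \<le> 200 * Suc L * Suc (length ys) * Suc (length xs)"
    "eval prog [NatV (of_bool a), entries_val xs, entries_val (x # rs), entries_val ys] (prog ! conv_f) (entries_val (convolution a xs (x # rs) ys)) t"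
    by (auto simp: runs_def)
  from runs_best[of "x # rs" ys L a "(0, [])"] Cons.prems obtain s where
    s: "s \<le> 100 * Suc L * Suc (length (x # rs))"
    "eval prog [NatV (of_bool a), entries_val (x # rs), entries_val ys, entry_val (0, [])] (prog ! best_f) (entry_val (best a (x # rs) ys (0, []))) s"
    by (auto simp: runs_def)
  \<comment> \<open>\<open>best\<close> takes at most \<open>100 * K\<close> steps for each entry of
    the new table; the other half of \<open>200 * K\<close> absorbs the constant overhead.\<close>
  define K where "K = Suc L * Suc (length ys)"
  have "Suc L * Suc (length (x # rs)) \<le> K"
    unfolding K_def using Cons.prems by (intro mult_le_mono) auto
  then have "s \<le> 100 * K"
    using s(1) unfolding mult.assoc by (meson le_trans mult_le_mono2)
  moreover have "t \<le> 200 * K * Suc (length xs)"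
    using t(1) unfolding K_def by (simp only: mult.assoc)
  moreover have "1 \<le> K"
    by (simp add: K_def)
  ultimately have "t + s + 40 \<le> 200 * K * Suc (length (x # xs))"
    by simp
  then have "t + s + 40 \<le> 200 * Suc L * Suc (length ys) * Suc (length (x # xs))"
    unfolding K_def by (simp only: mult.assoc)
  then show ?case
    by (intro runsI, simp add: prog_def, use wp_eval[OF t(2)] wp_eval[OF s(2)] in simp)
qed

section \<open>Probability of certificates\<close>

text \<open>Read \<open>x i\<close> as: leaf \<open>i\<close> is known to have the value
  \<open>a\<close>. For \<open>a = False\<close>, negating inputs and output exchanges
  \<open>And\<close> and \<open>Or\<close> by De Morgan, so both values follow the recursion of
  \<open>certainty\<close>.\<close>

definition sat :: "bool \<Rightarrow> formula \<Rightarrow> (nat \<Rightarrow> bool) \<Rightarrow> bool" where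
  "sat a \<phi> x \<longleftrightarrow> (if a then holds \<phi> x else \<not> holds \<phi> (\<lambda>i. \<not> x i))"

lemma sat_simps [simp]:
  "sat a (Leaf i) x \<longleftrightarrow> x i"
  "sat a (And fs) x \<longleftrightarrow> (if a then \<forall>f\<in>set fs. sat a f x else \<exists>f\<in>set fs. sat a f x)"
  "sat a (Or fs) x \<longleftrightarrow> (if \<not> a then \<forall>f\<in>set fs. sat a f x else \<exists>f\<in>set fs. sat a f x)"
  by (simp_all add: sat_def)

lemma holds_cong: "\<forall>i\<in>set (leaves \<phi>). x i = y i \<Longrightarrow> holds \<phi> x = holds \<phi> y"
proof (induction \<phi>)
  case (And fs)
  then have "holds f x = holds f y" if "f \<in> set fs" for f
    using that by simp
  then show ?case by simp
next
  case (Or fs)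
  then have "holds f x = holds f y" if "f \<in> set fs" for f
    using that by simp
  then show ?case by simp
qed simp

lemma sat_cong: "\<forall>i\<in>set (leaves \<phi>). x i = y i \<Longrightarrow> sat a \<phi> x = sat a \<phi> y"
  using holds_cong[of \<phi> x y] holds_cong[of \<phi> "\<lambda>i. \<not> x i" "\<lambda>i. \<not> y i"] by (simp add: sat_def)

lemma holds_mono:
  assumes "holds \<phi> x" and xy: "\<And>i. x i \<Longrightarrow> y i"
  shows "holds \<phi> y"
  using assms(1)
proof (induction \<phi>)
  case (Leaf i)
  then show ?case
    by (simp add: xy)
next
  case (And fs)
  have "\<forall>f\<in>set fs. holds f x"
    using And.prems by simp
  then have "\<forall>f\<in>set fs. holds f y"
    using And.IH by blast
  then show ?case by simp
next
  case (Or fs)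
  have "\<exists>f\<in>set fs. holds f x"
    using Or.prems by simp
  then have "\<exists>f\<in>set fs. holds f y"
    using Or.IH by blast
  then show ?case by simp
qed

text \<open>Formulas are monotone, so only the two extreme completions of the outcomes matter.\<close>

lemma determined_iff:
  "determined \<phi> S x \<longleftrightarrow>
     sat True \<phi> (\<lambda>i. i \<in> S \<and> x i) \<or> sat False \<phi> (\<lambda>i. i \<in> S \<and> \<not> x i)"
proof
  assume det: "determined \<phi> S x"
  show "sat True \<phi> (\<lambda>i. i \<in> S \<and> x i) \<or> sat False \<phi> (\<lambda>i. i \<in> S \<and> \<not> x i)"
  proof (cases "holds \<phi> x")
    case True
    then have "holds \<phi> (\<lambda>i. i \<in> S \<and> x i)"
      using det[unfolded determined_def, rule_format, of "\<lambda>i. i \<in> S \<and> x i"] by simp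
    then show ?thesis
      by (simp add: sat_def)
  next
    case False
    then have "\<not> holds \<phi> (\<lambda>i. i \<in> S \<longrightarrow> x i)"
      using det[unfolded determined_def, rule_format, of "\<lambda>i. i \<in> S \<longrightarrow> x i"] by simp
    then show ?thesis
      by (simp add: sat_def)
  qed
next
  assume "sat True \<phi> (\<lambda>i. i \<in> S \<and> x i) \<or> sat False \<phi> (\<lambda>i. i \<in> S \<and> \<not> x i)"
  then consider "holds \<phi> (\<lambda>i. i \<in> S \<and> x i)" | "\<not> holds \<phi> (\<lambda>i. i \<in> S \<longrightarrow> x i)"
    by (auto simp: sat_def)
  then show "determined \<phi> S x"
  proof cases
    case 1
    have "holds \<phi> y" if "\<forall>i\<in>S. y i = x i" for y
      using 1 by (rule holds_mono) (use that in auto)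
    from this this[of x] show ?thesis
      by (simp add: determined_def)
  next
    case 2
    have "\<not> holds \<phi> y" if "\<forall>i\<in>S. y i = x i" for y
    proof
      assume "holds \<phi> y"
      then have "holds \<phi> (\<lambda>i. i \<in> S \<longrightarrow> x i)"
        by (rule holds_mono) (use that in auto)
      with 2 show False ..
    qed
    from this this[of x] show ?thesis
      by (simp add: determined_def)
  qed
qed

lemma determined_mono:
  assumes "determined \<phi> S x" "S \<subseteq> S'"
  shows "determined \<phi> S' x"
  unfolding determined_def
proof (intro allI impI)
  fix y
  assume "\<forall>i\<in>S'. y i = x i"
  then have "\<forall>i\<in>S. y i = x i"
    using assms(2) by (simp add: subset_iff)
  with assms(1)[unfolded determined_def, THEN spec, of y] show "holds \<phi> y = holds \<phi> x"
    by (rule mp)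
qed

lemma determined_leaves: "set (leaves \<phi>) \<subseteq> S \<Longrightarrow> determined \<phi> S x"
  unfolding determined_def by (auto intro!: holds_cong)

text \<open>A certificate for true forces truth under every completion, including the one that a
  certificate for false refutes. This makes the probabilities of the two kinds of certificates add
  up, even when each kind has its own set of tests.\<close>

lemma sat_exclusive:
  assumes "sat True \<phi> (\<lambda>i. i \<in> S \<and> x i)"
  shows "\<not> sat False \<phi> (\<lambda>i. i \<in> S' \<and> \<not> x i)"
proof -
  have "holds \<phi> (\<lambda>i. i \<in> S \<and> x i)"
    using assms by (simp add: sat_def)
  then have "holds \<phi> (\<lambda>i. \<not> (i \<in> S' \<and> \<not> x i))"
    by (rule holds_mono) simp
  then show ?thesis
    by (simp add: sat_def)
qed

text \<open>Only nodes without children could make a formula constant. Consequently every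
  permutation pays for at least one test, and its cost can absorb the additive constant of the phase
  bound.\<close>

lemma branching_not_constant:
  "branching \<phi> \<Longrightarrow> holds \<phi> (\<lambda>_. True) \<and> \<not> holds \<phi> (\<lambda>_. False)"
proof (induction \<phi>)
  case (And fs)
  then have "fs \<noteq> []" by force
  with And show ?case
    by (auto simp: neq_Nil_conv)
next
  case (Or fs)
  then have "fs \<noteq> []" by force
  with Or show ?case
    by (auto simp: neq_Nil_conv)
qed simp

lemma not_determined_empty: "branching \<phi> \<Longrightarrow> \<not> determined \<phi> {} x"
  using branching_not_constant by (simp add: determined_iff sat_def)

section \<open>Independence in product distributions\<close>

lemma prob_pair_pmf_times:
  "measure_pmf.prob (pair_pmf M N) (X \<times> Y) = measure_pmf.prob M X * measure_pmf.prob N Y"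
proof -
  \<comment> \<open>Intersecting with the supports makes both factors countable.\<close>
  have "(X \<times> Y) \<inter> set_pmf (pair_pmf M N) = (X \<inter> set_pmf M) \<times> (Y \<inter> set_pmf N)"
    by auto
  then have "measure_pmf.prob (pair_pmf M N) (X \<times> Y) =
    measure_pmf.prob (pair_pmf M N) ((X \<inter> set_pmf M) \<times> (Y \<inter> set_pmf N))"
    by (metis measure_Int_set_pmf)
  also have "\<dots> = measure_pmf.prob M (X \<inter> set_pmf M) * measure_pmf.prob N (Y \<inter> set_pmf N)"
    by (intro measure_pmf_prob_product) auto
  finally show ?thesis
    by (simp add: measure_Int_set_pmf)
qed

definition depends_on :: "'a set \<Rightarrow> (('a \<Rightarrow> 'b) \<Rightarrow> bool) \<Rightarrow> bool" where
  "depends_on B X \<longleftrightarrow> (\<forall>x y. (\<forall>i\<in>B. x i = y i) \<longrightarrow> X x = X y)"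

lemma depends_onD: "depends_on B X \<Longrightarrow> (\<And>i. i \<in> B \<Longrightarrow> x i = y i) \<Longrightarrow> X x \<longleftrightarrow> X y"
  by (auto simp: depends_on_def)

text \<open>The product distribution splits into its coordinates in \<open>B\<close> and those
  outside; \<open>X\<close> sees only the former and, by disjointness, \<open>Y\<close> only the
  latter.\<close>

lemma prob_Pi_pmf_conj:
  assumes A: "finite A" and X: "depends_on B X" and Y: "depends_on B' Y"
    and B: "B \<subseteq> A" "B' \<subseteq> A" "B \<inter> B' = {}"
  shows "measure_pmf.prob (Pi_pmf A d p) {x. X x \<and> Y x} =
    measure_pmf.prob (Pi_pmf A d p) {x. X x} * measure_pmf.prob (Pi_pmf A d p) {x. Y x}"
proof -
  let ?M = "Pi_pmf B d p" and ?N = "Pi_pmf (A - B) d p"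
  let ?h = "\<lambda>(f, g) x. if x \<in> B then f x else g x"
  have "Pi_pmf (B \<union> (A - B)) d p = map_pmf ?h (pair_pmf ?M ?N)"
    using A B by (intro Pi_pmf_union) (auto dest: finite_subset)
  moreover have "B \<union> (A - B) = A"
    using B by auto
  ultimately have M: "Pi_pmf A d p = map_pmf ?h (pair_pmf ?M ?N)"
    by simp
  have X': "X (?h (f, g)) \<longleftrightarrow> X f" and Y': "Y (?h (f, g)) \<longleftrightarrow> Y g" for f g
    using B by (auto intro!: depends_onD[OF X] depends_onD[OF Y])
  have "?h -` {x. X x \<and> Y x} = {x. X x} \<times> {x. Y x}" "?h -` {x. X x} = {x. X x} \<times> UNIV"
    "?h -` {x. Y x} = UNIV \<times> {x. Y x}"
    using X' Y' by auto
  then show ?thesis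
    by (simp add: M prob_pair_pmf_times)
qed

text \<open>Distinct leaves make the first child independent of the remaining ones; this is where
  the read-once property enters. Disjunctions follow by inclusion-exclusion.\<close>

lemma prob_Pi_pmf_combine_all:
  fixes Z :: "'c \<Rightarrow> ('a \<Rightarrow> 'b) \<Rightarrow> bool" and L :: "'c \<Rightarrow> 'a list"
  assumes A: "finite A"
    and fs: "\<And>f. f \<in> set fs \<Longrightarrow> depends_on (set (L f)) (Z f) \<and> set (L f) \<subseteq> A"
    and dist: "distinct (concat (map L fs))"
  shows "measure_pmf.prob (Pi_pmf A d p)
      {x. if a then \<forall>f\<in>set fs. Z f x else \<exists>f\<in>set fs. Z f x} =
    combine_all a (map (\<lambda>f. measure_pmf.prob (Pi_pmf A d p) {x. Z f x}) fs)"
  using fs dist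
proof (induction fs)
  case Nil
  show ?case by simp
next
  case (Cons f fs)
  let ?P = "measure_pmf.prob (Pi_pmf A d p)"
  let ?R = "\<lambda>x. if a then \<forall>f\<in>set fs. Z f x else \<exists>f\<in>set fs. Z f x"
  have R: "depends_on (set (concat (map L fs))) ?R"
    unfolding depends_on_def
  proof (intro allI impI)
    fix x y :: "'a \<Rightarrow> 'b"
    assume xy: "\<forall>i\<in>set (concat (map L fs)). x i = y i"
    have "Z g x = Z g y" if g: "g \<in> set fs" for g
    proof (rule depends_onD[of "set (L g)" "Z g"])
      show "depends_on (set (L g)) (Z g)"
        using Cons.prems(1)[of g] g by simp
      show "x i = y i" if "i \<in> set (L g)" for i
        using xy that g by auto
    qed
    then show "?R x = ?R y"
      by simp
  qed
  have conj: "?P {x. Z f x \<and> ?R x} = ?P {x. Z f x} * ?P {x. ?R x}"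
  proof (rule prob_Pi_pmf_conj[OF A _ R])
    show "depends_on (set (L f)) (Z f)" "set (L f) \<subseteq> A"
      using Cons.prems(1)[of f] by simp_all
    have "set (L g) \<subseteq> A" if "g \<in> set fs" for g
      using Cons.prems(1)[of g] that by simp
    then show "set (concat (map L fs)) \<subseteq> A"
      by auto
    show "set (L f) \<inter> set (concat (map L fs)) = {}"
      using Cons.prems(2) by simp
  qed
  have disj: "?P {x. Z f x \<or> ?R x} = ?P {x. Z f x} + ?P {x. ?R x} - ?P {x. Z f x \<and> ?R x}"
    using measure_Un3[of "{x. Z f x}" "Pi_pmf A d p" "{x. ?R x}"]
    by (simp add: measure_pmf.fmeasurable_eq_sets Collect_disj_eq Collect_conj_eq)
  have IH: "?P {x. ?R x} = combine_all a (map (\<lambda>f. ?P {x. Z f x}) fs)"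
  proof (rule Cons.IH)
    show "distinct (concat (map L fs))"
      using Cons.prems(2) by simp
  qed (use Cons.prems(1) in simp)
  show ?case
  proof (cases a)
    case True
    then show ?thesis
      using conj IH by (simp add: combine_def)
  next
    case False
    then show ?thesis
      using conj disj IH by (simp add: combine_def)
  qed
qed

text \<open>\<open>E i b\<close> says that outcome \<open>b\<close> at leaf \<open>i\<close> counts
  towards the certificate. Its dependence on \<open>i\<close> allows leaves outside a set of tests
  to be switched off.\<close>

lemma prob_sat:
  assumes "\<forall>i\<in>set (leaves \<phi>). measure_pmf.prob (p i) {b. E i b} = w i"
    and "finite A" "set (leaves \<phi>) \<subseteq> A" "distinct (leaves \<phi>)"
  shows "measure_pmf.prob (Pi_pmf A d p) {x. sat a \<phi> (\<lambda>i. E i (x i))} = certainty a w \<phi>"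
proof -
  let ?P = "measure_pmf.prob (Pi_pmf A d p)"
  have node: "?P {x. if b then \<forall>f\<in>set fs. sat a f (\<lambda>i. E i (x i)) else \<exists>f\<in>set fs. sat a f (\<lambda>i. E i (x i))} =
      combine_all b (map (certainty a w) fs)"
    if "\<And>f. f \<in> set fs \<Longrightarrow> ?P {x. sat a f (\<lambda>i. E i (x i))} = certainty a w f"
      "set (concat (map leaves fs)) \<subseteq> A" "distinct (concat (map leaves fs))" for b fs
  proof -
    have "depends_on (set (leaves f)) (\<lambda>x. sat a f (\<lambda>i. E i (x i)))" for f
      unfolding depends_on_def by (auto intro!: sat_cong)
    then show ?thesis
      using that assms(2)
      by (subst prob_Pi_pmf_combine_all[where L = leaves])
        (auto intro!: arg_cong[where f = "combine_all b"])
  qed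
  show ?thesis
    using assms(1,3,4)
  proof (induction \<phi>)
    case (Leaf i)
    have "map_pmf (\<lambda>x. x i) (Pi_pmf A d p) = p i"
      using Leaf assms(2) by (simp add: Pi_pmf_component)
    then have "measure_pmf.prob (p i) {b. E i b} = ?P ((\<lambda>x. x i) -` {b. E i b})"
      by (metis measure_map_pmf)
    then show ?case
      using Leaf by (simp add: vimage_def)
  next
    case (And fs)
    have "?P {x. sat a f (\<lambda>i. E i (x i))} = certainty a w f" if "f \<in> set fs" for f
    proof (rule And.IH[OF that])
      show "distinct (leaves f)"
        using And.prems that by (auto dest: distinct_concat_mapD)
    qed (use And.prems that in auto)
    from node[OF this, of fs a] show ?case
      using And.prems by simp
  next
    case (Or fs)
    have "?P {x. sat a f (\<lambda>i. E i (x i))} = certainty a w f" if "f \<in> set fs" for f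
    proof (rule Or.IH[OF that])
      show "distinct (leaves f)"
        using Or.prems that by (auto dest: distinct_concat_mapD)
    qed (use Or.prems that in auto)
    from node[OF this, of fs "\<not> a"] show ?case
      using Or.prems by simp
  qed
qed

section \<open>Expected cost of the phases\<close>

fun nub :: "nat list \<Rightarrow> nat list \<Rightarrow> nat list" where
  "nub [] seen = []"
| "nub (x # xs) seen = (if x \<in> set seen then nub xs seen else x # nub xs (x # seen))"

lemma set_nub: "set (nub xs seen) = set xs - set seen"
  by (induction xs seen rule: nub.induct) auto

lemma distinct_nub: "distinct (nub xs seen)"
  by (induction xs seen rule: nub.induct) (auto simp: set_nub)

text \<open>A prefix of the concatenated phases becomes a prefix of the permutation, so stopping
  after a phase costs at most the phases so far.\<close>

lemma nub_append: "\<exists>seen'. nub (xs @ ys) seen = nub xs seen @ nub ys seen'"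
  by (induction xs seen rule: nub.induct) auto

lemma sum_list_nub_le:
  fixes c :: "nat \<Rightarrow> nat"
  shows "(\<Sum>i\<leftarrow>nub xs seen. c i) \<le> (\<Sum>i\<leftarrow>xs. c i)"
  by (induction xs seen rule: nub.induct) auto

lemma sum_list_take_mono:
  fixes c :: "'a \<Rightarrow> nat"
  assumes "i \<le> j"
  shows "(\<Sum>x\<leftarrow>take i xs. c x) \<le> (\<Sum>x\<leftarrow>take j xs. c x)"
proof -
  have "take j xs = take i xs @ take (j - i) (drop i xs)"
    using assms by (metis le_add_diff_inverse take_add)
  then show ?thesis
    by simp
qed

lemma testing_cost_le:
  "determined \<phi> (set (take j \<pi>)) x \<Longrightarrow> testing_cost \<phi> c \<pi> x \<le> (\<Sum>i\<leftarrow>take j \<pi>. c i)"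
  unfolding testing_cost_def num_tests_def by (intro sum_list_take_mono Least_le)

lemma testing_cost_le_total: "testing_cost \<phi> c \<pi> x \<le> (\<Sum>i\<leftarrow>\<pi>. c i)"
proof -
  let ?m = "num_tests \<phi> \<pi> x"
  have "(\<Sum>i\<leftarrow>take ?m \<pi>. c i) \<le> (\<Sum>i\<leftarrow>take (max ?m (length \<pi>)) \<pi>. c i)"
    by (rule sum_list_take_mono) simp
  then show ?thesis
    by (simp add: testing_cost_def)
qed

lemma sum_pow2: "(\<Sum>k<m. 2 ^ k :: nat) = 2 ^ m - 1"
  by (induction m) auto

text \<open>Let \<open>k\<close> be the first phase whose tests determine the formula. The phases up
  to \<open>k\<close> cost at most \<open>2 * (2 ^ Suc k - 1) = 2 + 4 * (2 ^ k - 1)\<close>, and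
  \<open>2 ^ k - 1\<close> is the sum of the budgets of the phases before \<open>k\<close>, all of
  which fail.\<close>

lemma testing_cost_phases:
  assumes W: "\<And>k. k < M \<Longrightarrow> (\<Sum>i\<leftarrow>W k. c i) \<le> 2 * 2 ^ k"
    and \<pi>: "\<pi> = nub (concat (map W [0..<M]) @ ts) []"
    and total: "(\<Sum>i\<leftarrow>\<pi>. c i) \<le> 2 ^ M"
  shows "testing_cost \<phi> c \<pi> x \<le>
    2 + 4 * (\<Sum>k<M. 2 ^ k * of_bool (\<not> determined \<phi> (set (W k)) x))"
proof -
  define k where "k = (LEAST k. M \<le> k \<or> determined \<phi> (set (W k)) x)"
  have k: "M \<le> k \<or> determined \<phi> (set (W k)) x"
    unfolding k_def by (rule LeastI[of _ M]) simp
  have "k \<le> M"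
    unfolding k_def by (rule Least_le) simp
  have below: "\<not> determined \<phi> (set (W j)) x" if "j < k" for j
    using not_less_Least[OF that[unfolded k_def]] by simp
  have "(\<Sum>j<k. 2 ^ j :: nat) = (\<Sum>j<k. 2 ^ j * of_bool (\<not> determined \<phi> (set (W j)) x))"
    using below by (intro sum.cong) auto
  also have "\<dots> \<le> (\<Sum>j<M. 2 ^ j * of_bool (\<not> determined \<phi> (set (W j)) x))"
    using \<open>k \<le> M\<close> by (intro sum_mono2) auto
  finally have sum: "2 ^ k - 1 \<le> (\<Sum>j<M. 2 ^ j * of_bool (\<not> determined \<phi> (set (W j)) x) :: nat)"
    by (simp add: sum_pow2)
  have "testing_cost \<phi> c \<pi> x \<le> 2 + 4 * (2 ^ k - 1)"
  proof (cases "k = M")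
    \<comment> \<open>No phase succeeds, and the appended tests \<open>ts\<close> may be needed, but
      all tests together cost at most \<open>2 ^ M\<close>.\<close>
    case True
    have "testing_cost \<phi> c \<pi> x \<le> 2 ^ k"
      using testing_cost_le_total total True by (metis order_trans)
    moreover have "(1::nat) \<le> 2 ^ k"
      by simp
    ultimately show ?thesis
      by linarith
  next
    case False
    with \<open>k \<le> M\<close> have "k < M"
      by simp
    define A where "A = concat (map W [0..<Suc k])"
    have "[0..<M] = [0..<Suc k] @ [Suc k..<M]"
      using \<open>k < M\<close> by (metis Suc_leI le0 upt_add_eq_append le_add_diff_inverse)
    then have "\<pi> = nub (A @ (concat (map W [Suc k..<M]) @ ts)) []"
      by (simp add: \<pi> A_def del: upt_Suc)
    then obtain seen where "\<pi> = nub A [] @ nub (concat (map W [Suc k..<M]) @ ts) seen"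
      using nub_append by metis
    then have take: "take (length (nub A [])) \<pi> = nub A []"
      by simp
    have "determined \<phi> (set (W k)) x"
      using k \<open>k < M\<close> by simp
    then have "determined \<phi> (set (take (length (nub A [])) \<pi>)) x"
      by (rule determined_mono) (unfold take, auto simp: set_nub A_def)
    then have "testing_cost \<phi> c \<pi> x \<le> (\<Sum>i\<leftarrow>nub A []. c i)"
      using testing_cost_le take by metis
    also have "\<dots> \<le> (\<Sum>i\<leftarrow>A. c i)"
      by (rule sum_list_nub_le)
    also have "\<dots> \<le> 2 * (2 ^ Suc k - 1)"
    proof -
      have "(\<Sum>i\<leftarrow>concat (map W [0..<j]). c i) \<le> 2 * (2 ^ j - 1)" if "j \<le> M" for j
        using that
      proof (induction j)
        case (Suc j)
        then have "(\<Sum>i\<leftarrow>concat (map W [0..<Suc j]). c i) \<le> 2 * (2 ^ j - 1) + 2 * 2 ^ j"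
          using W[of j] by simp
        also have "\<dots> = 2 * (2 ^ Suc j - 1)"
          using one_le_power[of "2 :: nat" j] by simp
        finally show ?case .
      qed simp
      from this[of "Suc k"] show ?thesis
        using \<open>k < M\<close> unfolding A_def by simp
    qed
    also have "\<dots> = 2 + 4 * (2 ^ k - 1)"
      by (cases "2 ^ k :: nat") simp_all
    finally show ?thesis .
  qed
  with sum show ?thesis
    by linarith
qed

text \<open>The powers of two below \<open>T\<close> sum to at most \<open>2 * T - 1\<close>, which
  bounds the left side by \<open>8 * T - 2\<close>.\<close>

lemma sum_pow2_below:
  fixes T :: nat
  assumes "1 \<le> T"
  shows "2 + 4 * (\<Sum>k<m. 2 ^ k * of_bool (2 ^ k < T)) \<le> 8 * T"
proof -
  have "(\<Sum>k<m. 2 ^ k * of_bool (2 ^ k < T)) \<le> 2 * T - 1"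
  proof (induction m)
    case (Suc m)
    show ?case
    proof (cases "2 ^ m < T")
      case True
      have "(\<Sum>k<Suc m. 2 ^ k * of_bool (2 ^ k < T)) \<le> (\<Sum>k<Suc m. 2 ^ k :: nat)"
        by (intro sum_mono) auto
      also have "\<dots> \<le> 2 * T - 1"
        using True by (simp only: sum_pow2 power_Suc)
      finally show ?thesis .
    qed (use Suc in simp)
  qed simp
  then show ?thesis
    using assms by linarith
qed

text \<open>Probabilities are constrained only below \<open>n\<close>; the value \<open>0\<close>
  beyond keeps every weight in the unit interval, as the lemmas on \<open>certainty\<close>
  require.\<close>

definition outcome_weights :: "bool \<Rightarrow> nat \<Rightarrow> (nat \<Rightarrow> real) \<Rightarrow> nat \<Rightarrow> real" where
  "outcome_weights a n p i = (if i < n then (if a then p i else 1 - p i) else 0)"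

text \<open>This identifies the objective of the dynamic program as a probability. At a leaf outside
  \<open>S\<close> the event is empty, in agreement with weight \<open>0\<close>.\<close>

lemma prob_certificate:
  assumes inst: "na_ROF_instance n \<phi> p c"
  shows "measure_pmf.prob (assignment_pmf n p) {x. sat a \<phi> (\<lambda>i. i \<in> S \<and> x i = a)} =
    certainty a (restrict_weights (outcome_weights a n p) S) \<phi>"
proof -
  have \<phi>: "distinct (leaves \<phi>)" "set (leaves \<phi>) = {..<n}" and p: "\<And>i. i < n \<Longrightarrow> 0 < p i \<and> p i < 1"
    using inst by (auto simp: na_ROF_instance_def read_once_def)
  have "measure_pmf.prob (bernoulli_pmf (p i)) {b. i \<in> S \<and> b = a} =
      restrict_weights (outcome_weights a n p) S i" if "i < n" for i
  proof (cases "i \<in> S")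
    case True
    then have "{b. i \<in> S \<and> b = a} = {a}"
      by auto
    then show ?thesis
      using p[OF that] that True
      by (cases a) (simp_all add: restrict_weights_def outcome_weights_def measure_pmf_single)
  qed (simp add: restrict_weights_def)
  then show ?thesis
    unfolding assignment_pmf_def using \<phi>
    by (intro prob_sat[where E = "\<lambda>i b. i \<in> S \<and> b = a"]) auto
qed

lemma testing_cost_pos:
  assumes inst: "na_ROF_instance n \<phi> p c" and \<sigma>: "\<sigma> \<in> permutations_of_set {..<n}"
  shows "1 \<le> testing_cost \<phi> c \<sigma> x"
proof -
  have \<phi>: "branching \<phi>" "set (leaves \<phi>) = {..<n}" and c: "\<And>i. i < n \<Longrightarrow> 0 < c i"
    using inst by (auto simp: na_ROF_instance_def read_once_def)
  have set: "set \<sigma> = {..<n}"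
    using \<sigma> by (simp add: permutations_of_setD)
  have "determined \<phi> (set (take (length \<sigma>) \<sigma>)) x"
    using \<phi>(2) set by (simp add: determined_leaves)
  then have "determined \<phi> (set (take (num_tests \<phi> \<sigma> x) \<sigma>)) x"
    unfolding num_tests_def by (rule LeastI)
  then have "take (num_tests \<phi> \<sigma> x) \<sigma> \<noteq> []"
    using not_determined_empty[OF \<phi>(1)] by (metis list.set(1))
  then obtain i js where i: "take (num_tests \<phi> \<sigma> x) \<sigma> = i # js"
    by (cases "take (num_tests \<phi> \<sigma> x) \<sigma>") auto
  then have "i \<in> set \<sigma>"
    by (metis in_set_takeD list.set_intros(1))
  then have "0 < c i"
    using set c by auto
  then show ?thesis
    by (simp add: testing_cost_def i)
qed

text \<open>The tests of the optimal permutation that fit into the budget \<open>b\<close> determine the formula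
  whenever the permutation costs at most \<open>b\<close>, and both kinds of certificates in them are at most
  as likely as those found by the two tables.\<close>

lemma prob_not_determined_le:
  assumes inst: "na_ROF_instance n \<phi> p c" and \<sigma>: "\<sigma> \<in> permutations_of_set {..<n}"
    and T: "\<And>a. optimal_table n c C
      (\<lambda>S. certainty a (restrict_weights (outcome_weights a n p) S) \<phi>) {..<n} (T a)"
    and b: "b \<le> C"
  shows "measure_pmf.prob (assignment_pmf n p)
      {x. \<not> determined \<phi> (set (snd (T True ! b) @ snd (T False ! b))) x} \<le>
    measure_pmf.prob (assignment_pmf n p) {x. b < testing_cost \<phi> c \<sigma> x}"
proof -
  let ?P = "measure_pmf.prob (assignment_pmf n p)"
  let ?cert = "\<lambda>a S. {x. sat a \<phi> (\<lambda>i. i \<in> S \<and> x i = a)}"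
  let ?R = "\<lambda>a. set (snd (T a ! b))"
  have \<phi>: "set (leaves \<phi>) = {..<n}"
    using inst by (auto simp: na_ROF_instance_def read_once_def)
  have set: "set \<sigma> = {..<n}" and dist: "distinct \<sigma>"
    using \<sigma> by (simp_all add: permutations_of_setD)
  \<comment> \<open>\<open>S\<close> is the longest prefix of \<open>\<sigma>\<close> that fits into
    the budget. It does not depend on the assignment, yet contains all tests performed whenever
    \<open>\<sigma>\<close> stops within the budget.\<close>
  define J where "J = {j. j \<le> length \<sigma> \<and> (\<Sum>i\<leftarrow>take j \<sigma>. c i) \<le> b}"
  define S where "S = set (take (Max J) \<sigma>)"
  have J: "finite J" "0 \<in> J"
    by (auto simp: J_def)
  then have "Max J \<in> J"
    by (auto intro: Max_in)
  then have "(\<Sum>i\<in>S. c i) \<le> b"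
    using dist by (simp add: S_def J_def sum_list_distinct_conv_sum_set)
  moreover have "S \<inter> {..<n} = S"
    using set unfolding S_def by (auto dest: in_set_takeD)
  ultimately have S: "(\<Sum>i\<in>S \<inter> {..<n}. c i) \<le> b"
    by simp
  \<comment> \<open>The same \<open>S\<close> competes in both tables, so the two inequalities can
    be added although the table sets differ.\<close>
  have mono: "?P (?cert a S) \<le> ?P (?cert a (?R a))" for a
    unfolding prob_certificate[OF inst]
    using T[of a] S b by (fastforce simp: optimal_table_def)
  have split: "{x. determined \<phi> S x} = ?cert True S \<union> ?cert False S" for S
    by (auto simp: determined_iff)
  have excl: "?cert True S \<inter> ?cert False S' = {}" for S S'
    using sat_exclusive[of \<phi> S _ S'] by auto
  have "determined \<phi> S x" if "testing_cost \<phi> c \<sigma> x \<le> b" for x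
  proof -
    have det: "determined \<phi> (set (take (length \<sigma>) \<sigma>)) x"
      using \<phi> set by (simp add: determined_leaves)
    then have "determined \<phi> (set (take (num_tests \<phi> \<sigma> x) \<sigma>)) x"
      unfolding num_tests_def by (rule LeastI)
    moreover have "num_tests \<phi> \<sigma> x \<le> length \<sigma>"
      unfolding num_tests_def using det by (rule Least_le)
    then have "num_tests \<phi> \<sigma> x \<in> J"
      using that by (simp add: J_def testing_cost_def)
    then have "num_tests \<phi> \<sigma> x \<le> Max J"
      using J by simp
    ultimately show ?thesis
      unfolding S_def by (meson determined_mono set_take_subset_set_take)
  qed
  then have "?P {x. testing_cost \<phi> c \<sigma> x \<le> b} \<le> ?P {x. determined \<phi> S x}"
    by (intro measure_pmf.finite_measure_mono) auto
  also have "\<dots> = ?P (?cert True S) + ?P (?cert False S)"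
    unfolding split by (intro measure_pmf.finite_measure_Union excl) auto
  also have "\<dots> \<le> ?P (?cert True (?R True)) + ?P (?cert False (?R False))"
    using mono by (intro add_mono)
  also have "\<dots> = ?P (?cert True (?R True) \<union> ?cert False (?R False))"
    by (intro measure_pmf.finite_measure_Union[symmetric] excl) auto
  also have "\<dots> \<le> ?P {x. determined \<phi> (?R True \<union> ?R False) x}"
  proof (rule measure_pmf.finite_measure_mono)
    have "?cert True (?R True) \<subseteq> {x. determined \<phi> (?R True) x}"
      "?cert False (?R False) \<subseteq> {x. determined \<phi> (?R False) x}"
      unfolding split by blast+
    moreover have "{x. determined \<phi> (?R a) x} \<subseteq> {x. determined \<phi> (?R True \<union> ?R False) x}" for a
      by (cases a) (auto elim!: determined_mono)
    ultimately show "?cert True (?R True) \<union> ?cert False (?R False) \<subseteq>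
        {x. determined \<phi> (?R True \<union> ?R False) x}"
      by (meson Un_least order_trans)
  qed simp
  finally have "?P {x. testing_cost \<phi> c \<sigma> x \<le> b} \<le> ?P {x. determined \<phi> (?R True \<union> ?R False) x}" .
  moreover have "?P {x. \<not> Q x} = 1 - ?P {x. Q x}" for Q
    using measure_pmf.prob_compl[of "{x. Q x}" "assignment_pmf n p"]
    by (simp add: Compl_eq_Diff_UNIV[symmetric] Collect_neg_eq)
  ultimately show ?thesis
    by (simp add: not_le[symmetric])
qed

lemma finite_set_assignment_pmf: "finite (set_pmf (assignment_pmf n p))"
  unfolding assignment_pmf_def by (subst set_Pi_pmf) auto

lemma expected_cost_phases:
  assumes inst: "na_ROF_instance n \<phi> p c" and \<sigma>: "\<sigma> \<in> permutations_of_set {..<n}"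
    and T: "\<And>a. optimal_table n c C
      (\<lambda>S. certainty a (restrict_weights (outcome_weights a n p) S) \<phi>) {..<n} (T a)"
    and C: "C = (\<Sum>i<n. c i)" and M: "C < 2 ^ M" "\<And>k. k < M \<Longrightarrow> 2 ^ k \<le> C"
    and \<pi>: "\<pi> = nub (concat (map (\<lambda>k. snd (T True ! (2 ^ k)) @ snd (T False ! (2 ^ k))) [0..<M]) @ [0..<n]) []"
  shows "\<pi> \<in> permutations_of_set {..<n}" "expected_cost n \<phi> p c \<pi> \<le> 8 * expected_cost n \<phi> p c \<sigma>"
proof -
  let ?M = "assignment_pmf n p"
  let ?E = "measure_pmf.expectation ?M" and ?P = "measure_pmf.prob ?M"
  define W where "W k = snd (T True ! (2 ^ k)) @ snd (T False ! (2 ^ k))" for k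
  have W: "(\<Sum>i\<leftarrow>W k. c i) \<le> 2 * 2 ^ k" "set (W k) \<subseteq> {..<n}" if "k < M" for k
    using T[of True] T[of False] M(2)[OF that] by (fastforce simp: W_def optimal_table_def)+
  have \<pi>': "\<pi> = nub (concat (map W [0..<M]) @ [0..<n]) []"
    by (simp add: \<pi> W_def[abs_def])
  have "set (concat (map W [0..<M])) \<subseteq> {..<n}"
    using W(2) by (simp add: UN_subset_iff)
  then have set: "set \<pi> = {..<n}"
    by (auto simp: \<pi>' set_nub)
  moreover have dist: "distinct \<pi>"
    by (simp add: \<pi> distinct_nub)
  ultimately show "\<pi> \<in> permutations_of_set {..<n}"
    by (simp add: permutations_of_set_def)
  have "(\<Sum>i\<leftarrow>\<pi>. c i) = C"
    using dist set by (simp add: C sum_list_distinct_conv_sum_set)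
  then have total: "(\<Sum>i\<leftarrow>\<pi>. c i) \<le> 2 ^ M"
    using M(1) by simp
  have int: "integrable ?M f" for f :: "(nat \<Rightarrow> bool) \<Rightarrow> real"
    by (rule integrable_measure_pmf_finite) (rule finite_set_assignment_pmf)
  have prob: "?E (\<lambda>x. of_bool (Q x)) = ?P {x. Q x}" for Q
  proof -
    have "(\<lambda>x. of_bool (Q x)) = (indicator {x. Q x} :: _ \<Rightarrow> real)"
      by (auto simp: indicator_def)
    then show ?thesis
      by simp
  qed
  have expand: "?E (\<lambda>x. real (2 + 4 * (\<Sum>k<M. 2 ^ k * of_bool (Q k x)))) =
      2 + 4 * (\<Sum>k<M. 2 ^ k * ?P {x. Q k x})" for Q
    by (simp add: int prob Bochner_Integration.integral_sum del: sum_mult_of_bool_eq)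
  have "expected_cost n \<phi> p c \<pi> \<le>
      ?E (\<lambda>x. real (2 + 4 * (\<Sum>k<M. 2 ^ k * of_bool (\<not> determined \<phi> (set (W k)) x))))"
    unfolding expected_cost_def
    using testing_cost_phases[OF W(1) \<pi>' total] by (intro integral_mono int of_nat_mono)
  also have "\<dots> = 2 + 4 * (\<Sum>k<M. 2 ^ k * ?P {x. \<not> determined \<phi> (set (W k)) x})"
    by (rule expand)
  \<comment> \<open>The only comparison of the two permutations. It holds for the probabilities at
    each budget; on a single assignment a phase may fail although \<open>\<sigma>\<close> is
    cheap.\<close>
  also have "\<dots> \<le> 2 + 4 * (\<Sum>k<M. 2 ^ k * ?P {x. 2 ^ k < testing_cost \<phi> c \<sigma> x})"
    unfolding W_def using M(2)
    by (intro add_left_mono mult_left_mono sum_mono prob_not_determined_le[OF inst \<sigma> T]) auto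
  also have "\<dots> = ?E (\<lambda>x. real (2 + 4 * (\<Sum>k<M. 2 ^ k * of_bool (2 ^ k < testing_cost \<phi> c \<sigma> x))))"
    by (rule expand[symmetric])
  also have "\<dots> \<le> ?E (\<lambda>x. real (8 * testing_cost \<phi> c \<sigma> x))"
    by (intro integral_mono int of_nat_mono sum_pow2_below testing_cost_pos[OF inst \<sigma>])
  also have "\<dots> = 8 * expected_cost n \<phi> p c \<sigma>"
    by (simp add: expected_cost_def)
  finally show "expected_cost n \<phi> p c \<pi> \<le> 8 * expected_cost n \<phi> p c \<sigma>" .
qed

section \<open>Running time of the algorithm\<close>

lemma map_step_table: "map f (step_table k b C hi lo) = step_table k b C (f hi) (f lo)"
  by (simp add: step_table_def)

lemma length_convolutions:
  "\<forall>T\<in>set Ts. length T = Suc C \<Longrightarrow> length (convolutions C a Ts) = Suc C"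
  by (cases Ts) (simp_all add: step_table_def)

text \<open>Costs are at least \<open>1\<close>, so a certificate has no more tests than its budget.
  This bounds the time for concatenating certificates.\<close>

lemma optimal_table_length_le:
  assumes T: "optimal_table n c C F L T" and c: "\<And>i. i < n \<Longrightarrow> 0 < c i" and e: "e \<in> set T"
  shows "length (snd e) \<le> C"
proof -
  from e T obtain b where b: "b \<le> C" "e = T ! b"
    by (auto simp: in_set_conv_nth optimal_table_def less_Suc_eq_le)
  then have sub: "set (snd e) \<subseteq> {..<n}" and le: "(\<Sum>i\<leftarrow>snd e. c i) \<le> b"
    using T by (auto simp: optimal_table_def)
  have "(\<Sum>i\<leftarrow>snd e. 1) \<le> (\<Sum>i\<leftarrow>snd e. c i)"
    using sub c by (intro sum_list_mono) (auto simp: Suc_le_eq)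
  then show ?thesis
    using le b by (simp add: sum_list_triv)
qed

abbreviation mode_val :: "bool \<Rightarrow> val" where
  "mode_val a \<equiv> NatV (if a then 1 else 2)"

abbreviation reals_val :: "nat \<Rightarrow> (nat \<Rightarrow> real) \<Rightarrow> val" where
  "reals_val n q \<equiv> list_val (map (\<lambda>i. RealV (q i)) [0..<n])"

abbreviation costs_val :: "nat \<Rightarrow> (nat \<Rightarrow> nat) \<Rightarrow> val" where
  "costs_val n c \<equiv> list_val (map (\<lambda>i. NatV (c i)) [0..<n])"

text \<open>The unit of time per piece of the formula. It is cubic because a convolution forms
  quadratically many pairs of entries, each of which may copy up to \<open>C\<close> tests.\<close>

abbreviation table_time :: "nat \<Rightarrow> nat" where
  "table_time C \<equiv> 400 * (C + 2) ^ 3"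

lemma cube_ge: "C + 2 \<le> (C + 2) ^ 3" for C :: nat
  by (rule self_le_power) auto

text \<open>A list cell raises the number of units by \<open>2 * size f + 2\<close>: all but one pay
  for the table of \<open>f\<close>, and the last one pays for the convolution.\<close>

lemma runs_tables:
  assumes tab: "\<And>f. f \<in> set fs \<Longrightarrow> runs table_f [m, qs, cs, NatV C, formula_val f]
      (entries_val (table a q c C f)) (table_time C * (2 * size f + 1))"
    and len: "\<And>f. f \<in> set fs \<Longrightarrow> length (table a q c C f) = Suc C"
    and lens: "\<And>f e. f \<in> set fs \<Longrightarrow> e \<in> set (table a q c C f) \<Longrightarrow> length (snd e) \<le> C"
  shows "runs tables_f [m, qs, cs, NatV C, NatV (of_bool d), list_val (map formula_val fs)]
      (entries_val (convolutions C d (map (table a q c C) fs)))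
      (table_time C * (2 * size_list size fs + 1))"
  using assms
proof (induction fs)
  case Nil
  let ?e = "PairV (RealV (of_bool d)) EmptyV"
  obtain t where t: "t \<le> 30 * Suc (Suc C - 0)"
    "eval prog [NatV 0, NatV 0, NatV C, ?e, ?e] (prog ! step_table_f) (list_val (step_table 0 0 C ?e ?e)) t"
    using runs_step_table[of 0 0 C ?e ?e] unfolding runs_def by blast
  have "t + 40 \<le> table_time C"
    using t(1) cube_ge[of C] by simp
  then show ?case
    by (intro runsI, simp add: prog_def, use wp_eval[OF t(2)] in \<open>simp add: map_step_table\<close>)
next
  case (Cons f fs)
  let ?K = "(C + 2) ^ 3"
  let ?T = "table a q c C f" and ?U = "convolutions C d (map (table a q c C) fs)"
  have lenU: "length ?U = Suc C" and lenT: "length ?T = Suc C"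
    using Cons.prems(2) by (simp_all add: length_convolutions)
  obtain s where s: "s \<le> table_time C * (2 * size f + 1)"
    "eval prog [m, qs, cs, NatV C, formula_val f] (prog ! table_f) (entries_val ?T) s"
    using Cons.prems(1)[of f] unfolding runs_def by auto
  obtain t where t: "t \<le> table_time C * (2 * size_list size fs + 1)"
    "eval prog [m, qs, cs, NatV C, NatV (of_bool d), list_val (map formula_val fs)] (prog ! tables_f)
      (entries_val ?U) t"
  proof -
    have "runs tables_f [m, qs, cs, NatV C, NatV (of_bool d), list_val (map formula_val fs)]
        (entries_val ?U) (table_time C * (2 * size_list size fs + 1))"
      by (rule Cons.IH) (rule Cons.prems[OF list.set_intros(2)]; assumption)+
    then show thesis
      using that unfolding runs_def by blast
  qed
  have "runs conv_f [NatV (of_bool d), entries_val ?T, entries_val [], entries_val ?U]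
      (entries_val (convolution d ?T [] ?U)) (200 * Suc C * Suc (length ?U) * Suc (length ?T))"
    using Cons.prems(3)[of f] lenU lenT by (intro runs_convolution) auto
  moreover have "200 * Suc C * Suc (length ?U) * Suc (length ?T) \<le> 200 * ?K"
    unfolding lenU lenT power3_eq_cube mult.assoc by (intro mult_le_mono) simp_all
  ultimately obtain u where u: "u \<le> 200 * ?K"
    "eval prog [NatV (of_bool d), entries_val ?T, entries_val [], entries_val ?U] (prog ! conv_f)
      (entries_val (convolution d ?T [] ?U)) u"
    unfolding runs_def by (meson le_trans)
  have "8 \<le> ?K"
    using power_mono[of 2 "C + 2" 3] by simp
  then have "s + t + u + 60 \<le> table_time C * (2 * size_list size (f # fs) + 1)"
    using s(1) t(1) u(1) by (simp add: algebra_simps)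
  then show ?case
    by (intro runsI, simp add: prog_def,
      use wp_eval[OF s(2)] wp_eval[OF t(2)] wp_eval[OF u(2)] in simp)
qed

lemma runs_table:
  assumes q: "\<And>i. 0 \<le> q i" "\<And>i. q i \<le> 1" and c: "\<And>i. i < n \<Longrightarrow> 0 < c i" and n: "n \<le> C"
    and "distinct (leaves \<phi>)" "set (leaves \<phi>) \<subseteq> {..<n}"
  shows "runs table_f [mode_val a, reals_val n q, costs_val n c, NatV C, formula_val \<phi>]
      (entries_val (table a q c C \<phi>)) (table_time C * (2 * size \<phi> + 1))"
proof -
  let ?runs = "\<lambda>f. runs table_f [mode_val a, reals_val n q, costs_val n c, NatV C, formula_val f]
      (entries_val (table a q c C f)) (table_time C * (2 * size f + 1))"
  have node: "runs tables_f [mode_val a, reals_val n q, costs_val n c, NatV C, NatV (of_bool d),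
        list_val (map formula_val fs)] (entries_val (convolutions C d (map (table a q c C) fs)))
        (table_time C * (2 * size_list size fs + 1))"
    if IH: "\<And>f. f \<in> set fs \<Longrightarrow> distinct (leaves f) \<Longrightarrow> set (leaves f) \<subseteq> {..<n} \<Longrightarrow> ?runs f"
      and fs: "distinct (concat (map leaves fs))" "set (concat (map leaves fs)) \<subseteq> {..<n}" for fs d
  proof (rule runs_tables)
    fix f
    assume f: "f \<in> set fs"
    have l: "distinct (leaves f)" "set (leaves f) \<subseteq> {..<n}"
      using distinct_concat_mapD[OF fs(1) f] fs(2) f by auto
    show "?runs f"
      by (rule IH[OF f l])
    note opt = optimal_table_table[where q = q and a = a and c = c and C = C, OF q l]
    show "length (table a q c C f) = Suc C"
      using opt by (simp add: optimal_table_def)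
    show "length (snd e) \<le> C" if "e \<in> set (table a q c C f)" for e
      using optimal_table_length_le[OF opt c that] .
  qed
  have K: "8 \<le> (C + 2) ^ 3"
    using power_mono[of 2 "C + 2" 3] by simp
  show ?thesis
    using assms(5,6)
  proof (induction \<phi>)
    case (Leaf i)
    let ?hi = "PairV (RealV (q i)) (PairV (NatV i) EmptyV)" and ?lo = "PairV (RealV 0) EmptyV"
    have i: "i < n"
      using Leaf by simp
    obtain s where s: "s \<le> 20 * Suc i"
      "eval prog [costs_val n c, NatV i] (prog ! nth_f) (NatV (c i)) s"
      using runs_nth[of i "map (\<lambda>i. NatV (c i)) [0..<n]"] i unfolding runs_def by auto
    obtain t where t: "t \<le> 20 * Suc i"
      "eval prog [reals_val n q, NatV i] (prog ! nth_f) (RealV (q i)) t"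
      using runs_nth[of i "map (\<lambda>i. RealV (q i)) [0..<n]"] i unfolding runs_def by auto
    obtain u where u: "u \<le> 30 * Suc (Suc C - 0)"
      "eval prog [NatV (c i), NatV 0, NatV C, ?hi, ?lo] (prog ! step_table_f)
        (list_val (step_table (c i) 0 C ?hi ?lo)) u"
      using runs_step_table unfolding runs_def by blast
    have "s + t + u + 60 \<le> table_time C"
      using s(1) t(1) u(1) i n cube_ge[of C] K by simp
    then show ?case
      by (intro runsI, simp add: prog_def,
        use wp_eval[OF s(2)] wp_eval[OF t(2)] wp_eval[OF u(2)] in \<open>simp add: map_step_table\<close>)
  next
    case (And fs)
    obtain t where t: "t \<le> table_time C * (2 * size_list size fs + 1)"
      "eval prog [mode_val a, reals_val n q, costs_val n c, NatV C, NatV (of_bool a),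
        list_val (map formula_val fs)] (prog ! tables_f)
        (entries_val (convolutions C a (map (table a q c C) fs))) t"
      using node[of fs a] And unfolding runs_def by auto
    have "t + 60 \<le> table_time C * (2 * size (And fs) + 1)"
      using t(1) K by (simp add: algebra_simps)
    then show ?case
      by (intro runsI, simp add: prog_def, cases a) (use wp_eval[OF t(2)] in simp_all)
  next
    case (Or fs)
    obtain t where t: "t \<le> table_time C * (2 * size_list size fs + 1)"
      "eval prog [mode_val a, reals_val n q, costs_val n c, NatV C, NatV (of_bool (\<not> a)),
        list_val (map formula_val fs)] (prog ! tables_f)
        (entries_val (convolutions C (\<not> a) (map (table a q c C) fs))) t"
      using node[of fs "\<not> a"] Or unfolding runs_def by auto
    have "t + 60 \<le> table_time C * (2 * size (Or fs) + 1)"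
      using t(1) K by (simp add: algebra_simps)
    then show ?case
      by (intro runsI, simp add: prog_def, cases a) (use wp_eval[OF t(2)] in simp_all)
  qed
qed

text \<open>Of the slack \<open>3\<close> of each child, one pays for its list cell. At least two
  children then leave \<open>4\<close>, which pays for the node itself and for its own slack of
  \<open>3\<close>.\<close>

lemma size_le_leaves: "branching \<phi> \<Longrightarrow> size \<phi> + 3 \<le> 3 * length (leaves \<phi>)"
proof (induction \<phi>)
  case (Leaf i)
  show ?case by simp
next
  case (And fs)
  have "size_list size fs + 2 * length fs \<le> 3 * length (concat (map leaves fs))"
    if "\<And>f. f \<in> set fs \<Longrightarrow> size f + 3 \<le> 3 * length (leaves f)" for fs
    using that by (induction fs) (auto, fastforce)
  from this[of fs] And show ?case
    by auto
next
  case (Or fs)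
  have "size_list size fs + 2 * length fs \<le> 3 * length (concat (map leaves fs))"
    if "\<And>f. f \<in> set fs \<Longrightarrow> size f + 3 \<le> 3 * length (leaves f)" for fs
    using that by (induction fs) (auto, fastforce)
  from this[of fs] Or show ?case
    by auto
qed

section \<open>Timing of the list functions, the phases and the main program\<close>

lemma runs_compl:
  "runs compl_f [list_val (map RealV ps)] (list_val (map (\<lambda>p. RealV (1 - p)) ps)) (20 * Suc (length ps))"
proof (induction ps)
  case Nil
  show ?case by (rule runsI, simp add: prog_def, simp)
next
  case (Cons p ps)
  then obtain t where t: "t \<le> 20 * Suc (length ps)"
    "eval prog [list_val (map RealV ps)] (prog ! compl_f) (list_val (map (\<lambda>p. RealV (1 - p)) ps)) t"
    unfolding runs_def by blast
  show ?case
    by (rule runsI, simp add: prog_def, use t(1) wp_eval[OF t(2)] in simp)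
qed

lemma runs_upto: "runs upto_f [NatV b, NatV n] (nats_val [b..<n]) (20 * Suc (n - b))"
proof (induction "n - b" arbitrary: b)
  case 0
  then show ?case by (intro runsI, simp add: prog_def, simp)
next
  case (Suc m)
  then have "runs upto_f [NatV (Suc b), NatV n] (nats_val [Suc b..<n]) (20 * Suc m)"
    using Suc.hyps(1)[of "Suc b"] by (metis Suc_diff_Suc diff_Suc_1 zero_less_Suc zero_less_diff)
  then obtain t where t: "t \<le> 20 * Suc m"
    "eval prog [NatV (Suc b), NatV n] (prog ! upto_f) (nats_val [Suc b..<n]) t"
    unfolding runs_def by blast
  have "b < n" "[b..<n] = b # [Suc b..<n]"
    using Suc.hyps(2) by (simp_all add: upt_rec[of b])
  then show ?case
    by (intro runsI, simp add: prog_def,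
      use t(1) wp_eval[OF t(2)] Suc.hyps(2)[symmetric] in simp)
qed

lemma runs_member:
  "runs member_f [NatV x, nats_val xs] (NatV (of_bool (x \<in> set xs))) (40 * Suc (length xs))"
proof (induction xs)
  case Nil
  show ?case by (rule runsI, simp add: prog_def, simp)
next
  case (Cons y xs)
  then obtain t where t: "t \<le> 40 * Suc (length xs)"
    "eval prog [NatV x, nats_val xs] (prog ! member_f) (NatV (of_bool (x \<in> set xs))) t"
    unfolding runs_def by blast
  show ?case
    by (rule runsI, simp add: prog_def, cases "x = y"; cases "x < y")
      (use t(1) wp_eval[OF t(2)] in simp_all)
qed

lemma runs_nub:
  assumes "length xs + length seen \<le> l"
  shows "runs nub_f [nats_val xs, nats_val seen] (nats_val (nub xs seen)) (100 * Suc l * Suc (length xs))"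
  using assms
proof (induction xs arbitrary: seen)
  case Nil
  show ?case by (rule runsI, simp add: prog_def, simp)
next
  case (Cons x xs)
  let ?seen = "if x \<in> set seen then seen else x # seen"
  have "length xs + length ?seen \<le> l"
    using Cons.prems by simp
  from Cons.IH[OF this] obtain t where t: "t \<le> 100 * Suc l * Suc (length xs)"
    "eval prog [nats_val xs, nats_val ?seen] (prog ! nub_f) (nats_val (nub xs ?seen)) t"
    unfolding runs_def by blast
  obtain s where s: "s \<le> 40 * Suc (length seen)"
    "eval prog [NatV x, nats_val seen] (prog ! member_f) (NatV (of_bool (x \<in> set seen))) s"
    using runs_member unfolding runs_def by blast
  have "s + t + 40 \<le> 100 * Suc l * Suc (length (x # xs))"
    using s(1) t(1) Cons.prems by (simp add: algebra_simps)
  then show ?case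
    by (intro runsI, simp add: prog_def, cases "x \<in> set seen")
      (use wp_eval[OF t(2)] wp_eval[OF s(2)] in simp_all)
qed

text \<open>A phase performs two lookups at a position at most \<open>C\<close> and two
  concatenations whose first argument has at most \<open>C\<close> tests, so its time is linear in
  \<open>C\<close>, whatever follows. The budget is doubled by adding it to itself, since natural
  numbers cannot be multiplied in one step.\<close>

lemma runs_phases:
  assumes T: "length T = Suc C" "\<forall>e\<in>set T. length (snd e) \<le> C"
    and U: "length U = Suc C" "\<forall>e\<in>set U. length (snd e) \<le> C"
    and M: "C < 2 ^ M" "\<And>k. k < M \<Longrightarrow> 2 ^ k \<le> C" and "j \<le> M"
  shows "runs phases_f [NatV (2 ^ j), NatV C, entries_val T, entries_val U, nats_val ts]
    (nats_val (concat (map (\<lambda>k. snd (T ! (2 ^ k)) @ snd (U ! (2 ^ k))) [j..<M]) @ ts))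
    (200 * (C + 2) * Suc (M - j))"
  using \<open>j \<le> M\<close>
proof (induction "M - j" arbitrary: j)
  case 0
  then have "j = M" by simp
  then show ?case
    using M(1) by (intro runsI, simp add: prog_def, simp)
next
  case (Suc m)
  let ?rest = "\<lambda>j. concat (map (\<lambda>k. snd (T ! (2 ^ k)) @ snd (U ! (2 ^ k))) [j..<M]) @ ts"
  have j: "j < M" and m: "m = M - Suc j"
    using Suc.hyps(2) by simp_all
  have b: "2 ^ j \<le> C"
    by (rule M(2)[OF j])
  have "runs phases_f [NatV (2 ^ j + 2 ^ j), NatV C, entries_val T, entries_val U, nats_val ts]
      (nats_val (?rest (Suc j))) (200 * (C + 2) * Suc m)"
    using Suc.hyps(1)[OF m] j m by (simp add: mult_2)
  then obtain t where t: "t \<le> 200 * (C + 2) * Suc m"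
    "eval prog [NatV (2 ^ j + 2 ^ j), NatV C, entries_val T, entries_val U, nats_val ts]
      (prog ! phases_f) (nats_val (?rest (Suc j))) t"
    unfolding runs_def by blast
  obtain v S where v: "T ! (2 ^ j) = (v, S)"
    by (cases "T ! (2 ^ j)")
  obtain w R where w: "U ! (2 ^ j) = (w, R)"
    by (cases "U ! (2 ^ j)")
  have "T ! (2 ^ j) \<in> set T" "U ! (2 ^ j) \<in> set U"
    using b T(1) U(1) by (auto intro!: nth_mem)
  then have len: "length S \<le> C" "length R \<le> C"
    using T(2) U(2) v w by (metis snd_conv)+
  obtain s where s: "s \<le> 20 * Suc (2 ^ j)"
    "eval prog [entries_val T, NatV (2 ^ j)] (prog ! nth_f) (PairV (RealV v) (nats_val S)) s"
    using runs_nth[of "2 ^ j" "map entry_val T"] b T(1) v unfolding runs_def by auto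
  obtain s' where s': "s' \<le> 20 * Suc (2 ^ j)"
    "eval prog [entries_val U, NatV (2 ^ j)] (prog ! nth_f) (PairV (RealV w) (nats_val R)) s'"
    using runs_nth[of "2 ^ j" "map entry_val U"] b U(1) w unfolding runs_def by auto
  obtain u where u: "u \<le> 20 * Suc (length R)"
    "eval prog [nats_val R, nats_val (?rest (Suc j))] (prog ! append_f) (nats_val (R @ ?rest (Suc j))) u"
    using runs_append[of "map NatV R" "map NatV (?rest (Suc j))"] unfolding runs_def by auto
  obtain u' where u': "u' \<le> 20 * Suc (length S)"
    "eval prog [nats_val S, nats_val (R @ ?rest (Suc j))] (prog ! append_f)
      (nats_val (S @ R @ ?rest (Suc j))) u'"
    using runs_append[of "map NatV S" "map NatV (R @ ?rest (Suc j))"] unfolding runs_def by auto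
  have rest: "?rest j = S @ R @ ?rest (Suc j)"
    using j v w by (simp add: upt_rec[of j])
  define r where "r = ?rest (Suc j)"
  have "s \<le> 20 * Suc C" "s' \<le> 20 * Suc C" "u \<le> 20 * Suc C" "u' \<le> 20 * Suc C"
    using s(1) s'(1) u(1) u'(1) b len by simp_all
  then have "s + s' + t + u + u' + 60 \<le> 200 * (C + 2) * Suc (Suc m)"
    using t(1) by simp
  then have "s + s' + t + u + u' + 60 \<le> 200 * (C + 2) * Suc (M - j)"
    using j m by (simp add: Suc_diff_Suc)
  then show ?case
    unfolding rest
    using wp_eval[OF t(2)] wp_eval[OF s(2)] wp_eval[OF s'(2)] wp_eval[OF u(2)] wp_eval[OF u'(2)] b
    unfolding r_def[symmetric]
    by (intro runsI, simp add: prog_def, simp)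
qed

text \<open>The bound \<open>M \<le> C\<close> is far above the logarithm but sufficient for
  polynomial time.\<close>

lemma phase_count:
  fixes C :: nat
  shows "\<exists>M\<le>C. C < 2 ^ M \<and> (\<forall>k<M. 2 ^ k \<le> C)"
proof -
  define M where "M = (LEAST k. C < 2 ^ k)"
  have ex: "C < 2 ^ C"
    by (rule less_exp)
  have 1: "C < 2 ^ M"
    unfolding M_def using ex by (rule LeastI)
  have 2: "M \<le> C"
    unfolding M_def using ex by (rule Least_le)
  have "2 ^ k \<le> C" if "k < M" for k
    using not_less_Least[OF that[unfolded M_def]] by simp
  with 1 2 show ?thesis
    by blast
qed

text \<open>The fourth power arises twice: cubic convolutions over a formula of linear size, and the
  quadratic removal of repetitions from a list of quadratic length. Positive costs give
  \<open>n \<le> C\<close>, so \<open>C\<close> alone bounds everything.\<close>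

lemma runs_main:
  assumes inst: "na_ROF_instance n \<phi> p c" and C: "C = (\<Sum>i<n. c i)"
    and M: "C < 2 ^ M" "\<And>k. k < M \<Longrightarrow> 2 ^ k \<le> C" "M \<le> C"
    and T: "\<And>a. T a = table a (outcome_weights a n p) c C \<phi>"
    and \<pi>: "\<pi> = nub (concat (map (\<lambda>k. snd (T True ! (2 ^ k)) @ snd (T False ! (2 ^ k))) [0..<M]) @ [0..<n]) []"
  shows "runs 0 (instance_args n \<phi> p c) (nats_val \<pi>) (20000 * (C + 2) ^ 4)"
proof -
  have \<phi>: "branching \<phi>" "distinct (leaves \<phi>)" "set (leaves \<phi>) = {..<n}"
    and p: "\<And>i. i < n \<Longrightarrow> 0 < p i \<and> p i < 1" and c: "\<And>i. i < n \<Longrightarrow> 0 < c i"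
    using inst by (auto simp: na_ROF_instance_def read_once_def)
  have w: "0 \<le> outcome_weights a n p i" "outcome_weights a n p i \<le> 1" for a i
    using p[of i] by (auto simp: outcome_weights_def)
  have "(\<Sum>i<n. 1) \<le> C"
    unfolding C using c by (intro sum_mono) (simp add: Suc_le_eq)
  then have n: "n \<le> C"
    by simp
  have opt: "optimal_table n c C
      (\<lambda>S. certainty a (restrict_weights (outcome_weights a n p) S) \<phi>) {..<n} (T a)" for a
    using optimal_table_table[where q = "outcome_weights a n p" and a = a and n = n and c = c and C = C,
      OF w \<phi>(2)] \<phi>(3) by (simp add: T)
  have lenT: "length (T a) = Suc C" "\<forall>e\<in>set (T a). length (snd e) \<le> C" for a
    using opt[of a] optimal_table_length_le[OF opt c] by (auto simp: optimal_table_def)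
  have "length (leaves \<phi>) = n"
    using \<phi>(2,3) by (metis card_lessThan distinct_card)
  then have size: "2 * size \<phi> + 1 \<le> 6 * (C + 2)"
    using size_le_leaves[OF \<phi>(1)] n by simp
  define N where "N = C + 2"
  have N: "C \<le> N" "2 \<le> N"
    by (simp_all add: N_def)
  define r where "r = concat (map (\<lambda>k. snd (T True ! (2 ^ k)) @ snd (T False ! (2 ^ k))) [0..<M]) @ [0..<n]"
  \<comment> \<open>Each of the \<open>M\<close> phases contributes two certificates of at most
    \<open>C\<close> tests.\<close>
  have "length r \<le> 2 * C * M + n"
  proof -
    have "length (concat (map (\<lambda>k. snd (T True ! (2 ^ k)) @ snd (T False ! (2 ^ k))) [0..<j])) \<le> 2 * C * j"
      if "j \<le> M" for j
      using that
    proof (induction j)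
      case (Suc j)
      then have "2 ^ j < length (T a)" for a
        using M(2)[of j] by (simp add: lenT le_imp_less_Suc)
      then have "length (snd (T a ! (2 ^ j))) \<le> C" for a
        using lenT(2)[of a] by simp
      from this[of True] this[of False] Suc show ?case
        by simp
    qed simp
    then show ?thesis
      by (simp add: r_def)
  qed
  also have "\<dots> \<le> 2 * N * N + N"
    using N M(3) n by (intro add_mono mult_le_mono) auto
  also have "\<dots> \<le> 3 * N\<^sup>2"
    using N by (simp add: power2_eq_square)
  finally have r: "length r \<le> 3 * N\<^sup>2" .
  have weights: "reals_val n p = reals_val n (outcome_weights True n p)"
    by (rule arg_cong[where f = list_val]) (simp add: outcome_weights_def)
  obtain t1 where t1: "t1 \<le> 20 * Suc n"
    "eval prog [costs_val n c] (prog ! sum_f) (NatV C) t1"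
    using runs_sum[of "map c [0..<n]"] unfolding runs_def
    by (auto simp: C sum_list_distinct_conv_sum_set atLeast0LessThan comp_def)
  have tables: "\<exists>t\<le>table_time C * (6 * N). eval prog
      [mode_val a, reals_val n (outcome_weights a n p), costs_val n c, NatV C, formula_val \<phi>]
      (prog ! table_f) (entries_val (T a)) t" for a
  proof -
    have "table_time C * (2 * size \<phi> + 1) \<le> table_time C * (6 * N)"
      using size unfolding N_def by (rule mult_le_mono2)
    moreover have "runs table_f
        [mode_val a, reals_val n (outcome_weights a n p), costs_val n c, NatV C, formula_val \<phi>]
        (entries_val (T a)) (table_time C * (2 * size \<phi> + 1))"
      unfolding T using \<phi>(3) by (intro runs_table[where n = n] w c n \<phi>(2)) simp_all
    ultimately show ?thesis
      unfolding runs_def using le_trans by blast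
  qed
  obtain t2 where t2: "t2 \<le> table_time C * (6 * N)"
    "eval prog [NatV 1, reals_val n p, costs_val n c, NatV C, formula_val \<phi>]
      (prog ! table_f) (entries_val (T True)) t2"
    using tables[of True] unfolding weights by auto
  obtain t3 where t3: "t3 \<le> table_time C * (6 * N)"
    "eval prog [NatV 2, reals_val n (outcome_weights False n p), costs_val n c, NatV C, formula_val \<phi>]
      (prog ! table_f) (entries_val (T False)) t3"
    using tables[of False] by auto
  have complement: "reals_val n (\<lambda>i. 1 - p i) = reals_val n (outcome_weights False n p)"
    by (rule arg_cong[where f = list_val]) (simp add: outcome_weights_def)
  obtain t4 where t4: "t4 \<le> 20 * Suc n"
    "eval prog [reals_val n p] (prog ! compl_f) (reals_val n (\<lambda>i. 1 - p i)) t4"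
    using runs_compl[of "map p [0..<n]"] unfolding runs_def by (auto simp: comp_def)
  note t4 = t4[unfolded complement]
  obtain t5 where t5: "t5 \<le> 20 * Suc n" "eval prog [NatV 0, NatV n] (prog ! upto_f) (nats_val [0..<n]) t5"
    using runs_upto[of 0 n] unfolding runs_def by auto
  obtain t6 where t6: "t6 \<le> 200 * (C + 2) * Suc M"
    "eval prog [NatV 1, NatV C, entries_val (T True), entries_val (T False), nats_val [0..<n]]
      (prog ! phases_f) (nats_val r) t6"
    using runs_phases[OF lenT lenT M(1,2), where j = 0 and ts = "[0..<n]"] unfolding runs_def r_def by auto
  obtain t7 where t7: "t7 \<le> 100 * Suc (3 * N\<^sup>2) * Suc (length r)"
    "eval prog [nats_val r, nats_val []] (prog ! nub_f) (nats_val \<pi>) t7"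
    using runs_nub[of r "[]" "3 * N\<^sup>2"] r unfolding runs_def \<pi> r_def by auto
  have N2: "1 \<le> N\<^sup>2" "N \<le> N\<^sup>2" "N\<^sup>2 \<le> N ^ 4" "1 \<le> N ^ 4"
    using N by (auto intro: self_le_power power_increasing)
  have "t7 \<le> 100 * (4 * N\<^sup>2) * (4 * N\<^sup>2)"
  proof -
    have "100 * Suc (3 * N\<^sup>2) * Suc (length r) \<le> 100 * (4 * N\<^sup>2) * (4 * N\<^sup>2)"
      using r N2 by (intro mult_le_mono) auto
    then show ?thesis
      using t7(1) by (rule le_trans[rotated])
  qed
  then have t7': "t7 \<le> 1600 * N ^ 4"
    by (simp add: power4_eq_xxxx power2_eq_square mult_ac)
  have "200 * (C + 2) * Suc M \<le> 200 * N * N"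
    using M(3) unfolding N_def by (intro mult_le_mono) simp_all
  then have "t6 \<le> 200 * N * N"
    using t6(1) by (rule le_trans[rotated])
  then have t6': "t6 \<le> 200 * N\<^sup>2"
    by (simp add: power2_eq_square)
  have "table_time C * (6 * N) = 2400 * (N ^ 3 * N)"
    by (simp add: N_def algebra_simps)
  also have "N ^ 3 * N = N ^ 4"
    by (simp add: power3_eq_cube power4_eq_xxxx)
  finally have "t2 \<le> 2400 * N ^ 4" "t3 \<le> 2400 * N ^ 4"
    using t2(1) t3(1) by simp_all
  moreover have "t1 \<le> 20 + 20 * n" "t4 \<le> 20 + 20 * n" "t5 \<le> 20 + 20 * n"
    using t1(1) t4(1) t5(1) by simp_all
  moreover have "n \<le> N"
    using n N by simp
  ultimately have "t1 + t2 + t3 + t4 + t5 + t6 + t7 + 100 \<le> 20000 * N ^ 4"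
    using t6' t7' N2 by linarith
  then have time: "t1 + t2 + t3 + t4 + t5 + t6 + t7 + 100 \<le> 20000 * (C + 2) ^ 4"
    by (simp only: N_def)
  show ?thesis
    unfolding instance_args_def
    using wp_eval[OF t1(2)] wp_eval[OF t2(2)] wp_eval[OF t3(2)] wp_eval[OF t4(2)]
      wp_eval[OF t5(2)] wp_eval[OF t6(2)] wp_eval[OF t7(2)] time
    by (intro runsI, simp add: prog_def, simp)
qed

lemma approximates_within_prog:
  assumes inst: "na_ROF_instance n \<phi> p c"
    and bound: "20000 * ((\<Sum>i<n. c i) + 2) ^ 4 \<le> B"
  shows "approximates_within 8 prog n \<phi> p c B"
proof -
  define C where "C = (\<Sum>i<n. c i)"
  define T where "T a = table a (outcome_weights a n p) c C \<phi>" for a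
  have \<phi>: "branching \<phi>" "distinct (leaves \<phi>)" "set (leaves \<phi>) = {..<n}"
    and p: "\<And>i. i < n \<Longrightarrow> 0 < p i \<and> p i < 1" and c: "\<And>i. i < n \<Longrightarrow> 0 < c i"
    using inst by (auto simp: na_ROF_instance_def read_once_def)
  have w: "0 \<le> outcome_weights a n p i" "outcome_weights a n p i \<le> 1" for a i
    using p[of i] by (auto simp: outcome_weights_def)
  have opt: "optimal_table n c C
      (\<lambda>S. certainty a (restrict_weights (outcome_weights a n p) S) \<phi>) {..<n} (T a)" for a
    using optimal_table_table[where q = "outcome_weights a n p" and a = a and n = n and c = c and C = C,
      OF w \<phi>(2)] \<phi>(3) by (simp add: T_def)
  obtain M where M: "C < 2 ^ M" "\<And>k. k < M \<Longrightarrow> 2 ^ k \<le> C" "M \<le> C"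
    using phase_count[of C] by blast
  define \<pi> where "\<pi> = nub (concat (map (\<lambda>k. snd (T True ! (2 ^ k)) @ snd (T False ! (2 ^ k))) [0..<M]) @ [0..<n]) []"
  note cost = expected_cost_phases[OF inst _ opt C_def M(1,2) \<pi>_def]
  have ne: "permutations_of_set {..<n} \<noteq> {}"
    by simp
  then have "optimal_cost n \<phi> p c \<in> expected_cost n \<phi> p c ` permutations_of_set {..<n}"
    unfolding optimal_cost_def by (intro Min_in) auto
  then obtain \<sigma> where \<sigma>: "\<sigma> \<in> permutations_of_set {..<n}"
    "optimal_cost n \<phi> p c = expected_cost n \<phi> p c \<sigma>"
    by auto
  from runs_main[OF inst C_def M T_def \<pi>_def] obtain t where
    "t \<le> 20000 * (C + 2) ^ 4" "eval prog (instance_args n \<phi> p c) (prog ! 0) (nats_val \<pi>) t"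
    unfolding runs_def by blast
  moreover have "prog \<noteq> []" "prog ! 0 = hd prog"
    by (simp_all add: prog_def)
  ultimately show ?thesis
    using cost[OF \<sigma>(1)] bound \<sigma>(2)
    unfolding approximates_within_def computes_def C_def by (metis le_trans)
qed

theorem theorem6:
  shows "\<exists>P :: program.
    (\<exists>q :: nat poly poly. \<forall>n \<phi> p c. na_ROF_instance n \<phi> p c \<longrightarrow>
       approximates_within 8 P n \<phi> p c (poly2 q n (\<Sum>i<n. c i))) \<and>
    (\<exists>r :: nat poly. \<forall>n \<phi> p c. na_ROF_instance n \<phi> p c \<and> (\<forall>i<n. c i = 1) \<longrightarrow>
       approximates_within 8 P n \<phi> p c (poly r n))"
proof (intro exI[of _ prog] conjI)
  \<comment> \<open>The polynomial \<open>20000 * (y + 2) ^ 4\<close> in the second variable, the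
    total cost; the first variable does not occur since \<open>n\<close> is at most that
    total.\<close>
  let ?q = "smult [:20000:] ([:[:2:], 1:] ^ 4) :: nat poly poly"
  have "poly2 ?q n m = 20000 * (m + 2) ^ 4" for n m
    by (simp add: poly2_def poly_power)
  then show "\<exists>q :: nat poly poly. \<forall>n \<phi> p c. na_ROF_instance n \<phi> p c \<longrightarrow>
      approximates_within 8 prog n \<phi> p c (poly2 q n (\<Sum>i<n. c i))"
    by (intro exI[of _ ?q]) (simp add: approximates_within_prog)
  \<comment> \<open>With unit costs the total cost is \<open>n\<close>, so the same bound is a
    polynomial in \<open>n\<close>.\<close>
  let ?r = "smult 20000 ([:2, 1:] ^ 4) :: nat poly"
  have "poly ?r n = 20000 * (n + 2) ^ 4" for n
    by (simp add: poly_power)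
  then show "\<exists>r :: nat poly. \<forall>n \<phi> p c. na_ROF_instance n \<phi> p c \<and> (\<forall>i<n. c i = 1) \<longrightarrow>
      approximates_within 8 prog n \<phi> p c (poly r n)"
    by (intro exI[of _ ?r]) (auto intro!: approximates_within_prog)
qed

end
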